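(* Let $\Phi:(1,\infty)\to(0,\infty)$ be a non-increasing function and let $$\Psi:\{(\gamma,\beta)\in[0,\infty)\times(1,\infty):0\le\gamma<\Phi(\beta)<\infty\}\to[0,\infty)$$ be right-continuous in its first argument and such that $\Psi(\gamma_1,\beta)\le\Psi(\gamma_2,\beta)$ for $0\le\gamma_1\le\gamma_2<\Phi(\beta)$, with the property that for all BMO-martingales $M$ and all $\beta\in(1,\infty)$ $$\|M\|_{\mathrm{BMO}_2}<\Phi(\beta)\quad\text{implies}\quad \mathcal{RH}_\beta(\mathcal E(M))\le\Psi(\|M\|_{\mathrm{BMO}_2},\beta).$$ Then for every BMO-martingale $M$, every $\beta\in(1,\infty)$ and every integer $N\ge1$ with $\mathrm{sl}_N(M)<\Phi(\beta)$ one has $$\mathcal{RH}_\beta(\mathcal E(M))\le\big[\Psi(\mathrm{sl}_N(M),\beta)\big]^N.$$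
   Context: Let $T>0$ and let $(A,\mathcal A,\mathbb Q,(\mathcal A_t)_{t\in[0,T]})$ be a stochastic basis such that $(A,\mathcal A,\mathbb Q)$ is complete, $(\mathcal A_t)$ is right-continuous, $\mathcal A_0$ contains all null-sets, $\mathcal A=\mathcal A_T$, and all local martingales are continuous. A continuous martingale $M=(M_t)_{t\in[0,T]}$ with $M_0\equiv0$ is a BMO-martingale if there is $c>0$ with $\mathbb E(|M_T-M_\tau|^2|\mathcal A_\tau)\le c^2$ a.s. for all stopping times $\tau:A\to[0,T]$; $\|M\|_{\mathrm{BMO}_2}$ is the infimum of such $c$. For stopping times $\sigma\le\tau$ let ${}^\sigma M^\tau:=(M_{\tau\wedge t}-M_{\sigma\wedge t})_{t\in[0,T]}$. The $N$-sliceable number $\mathrm{sl}_N(M)$ is the infimum of all $\varepsilon>0$ such that there are stopping times $0=\tau_0\le\tau_1\le\cdots\le\tau_N=T$ with $\sup_{k=1,\dots,N}\|{}^{\tau_{k-1}}M^{\tau_k}\|_{\mathrm{BMO}_2}\le\varepsilon$. $\mathcal E(M)_t=e^{M_t-\frac12\langle M\rangle_t}$ (a martingale for BMO-martingales $M$). For $\beta\in(1,\infty)$, $\mathcal{RH}_\beta(\mathcal E(M))$ is the smallest $c\ge 0$ such that $\mathbb E(|\mathcal E(M)_T|^\beta|\mathcal A_\tau)^{1/\beta}\le c\,\mathcal E(M)_\tau$ a.s. for all stopping times $\tau:A\to[0,T]$ ($=\infty$ if there is no such $c$). *)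

theory Defs
  imports "HOL-Probability.Probability"
begin

text \<open>
  The time interval is \<open>[0,T]\<close>. Filtrations and processes are indexed by all reals, but only their
  values at times in \<open>[0,T]\<close> matter below. In particular, for \<open>[0,T]\<close>-valued \<open>\<tau>\<close> the library notions
  \<^const>\<open>stopping_time\<close> and \<^const>\<open>filtration.pre_sigma\<close> coincide with the usual ones
  over \<open>[0,T]\<close>, provided \<open>F T\<close> has the same measurable sets as \<open>M\<close>: for \<open>t < 0\<close> the event
  \<open>\<tau> \<le> t\<close> is empty, and for \<open>t \<ge> T\<close> it is the whole space.
\<close>

definition stopping_time_upto ::
    "'a measure \<Rightarrow> (real \<Rightarrow> 'a measure) \<Rightarrow> real \<Rightarrow> ('a \<Rightarrow> real) \<Rightarrow> bool" where
  "stopping_time_upto M F T \<tau> \<longleftrightarrow>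
     stopping_time F \<tau> \<and> (\<forall>\<omega>\<in>space M. 0 \<le> \<tau> \<omega> \<and> \<tau> \<omega> \<le> T)"

definition adapted :: "(real \<Rightarrow> 'a measure) \<Rightarrow> real \<Rightarrow> (real \<Rightarrow> 'a \<Rightarrow> real) \<Rightarrow> bool" where
  "adapted F T X \<longleftrightarrow> (\<forall>t\<in>{0..T}. X t \<in> borel_measurable (F t))"

definition martingale ::
    "'a measure \<Rightarrow> (real \<Rightarrow> 'a measure) \<Rightarrow> real \<Rightarrow> (real \<Rightarrow> 'a \<Rightarrow> real) \<Rightarrow> bool" where
  "martingale M F T X \<longleftrightarrow>
     adapted F T X \<and>
     (\<forall>t\<in>{0..T}. integrable M (X t)) \<and>
     (\<forall>s t. 0 \<le> s \<and> s \<le> t \<and> t \<le> T \<longrightarrow> (AE \<omega> in M. real_cond_exp M (F s) (X t) \<omega> = X s \<omega>))"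

definition continuous_paths :: "'a measure \<Rightarrow> real \<Rightarrow> (real \<Rightarrow> 'a \<Rightarrow> real) \<Rightarrow> bool" where
  "continuous_paths M T X \<longleftrightarrow> (\<forall>\<omega>\<in>space M. continuous_on {0..T} (\<lambda>t. X t \<omega>))"

definition cadlag_paths :: "'a measure \<Rightarrow> real \<Rightarrow> (real \<Rightarrow> 'a \<Rightarrow> real) \<Rightarrow> bool" where
  "cadlag_paths M T X \<longleftrightarrow>
     (\<forall>\<omega>\<in>space M.
        (\<forall>t\<in>{0..<T}. continuous (at_right t) (\<lambda>s. X s \<omega>)) \<and>
        (\<forall>t\<in>{0<..T}. \<exists>l. ((\<lambda>s. X s \<omega>) \<longlongrightarrow> l) (at_left t)))"

text \<open>
  On the closed interval \<open>[0,T]\<close> a localizing sequence has to reach \<open>T\<close> after finitely many steps,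
  almost surely. The initial value need not be integrable.
\<close>

definition local_martingale ::
    "'a measure \<Rightarrow> (real \<Rightarrow> 'a measure) \<Rightarrow> real \<Rightarrow> (real \<Rightarrow> 'a \<Rightarrow> real) \<Rightarrow> bool" where
  "local_martingale M F T X \<longleftrightarrow>
     adapted F T X \<and> cadlag_paths M T X \<and>
     (\<exists>\<rho> :: nat \<Rightarrow> 'a \<Rightarrow> real.
        (\<forall>n. stopping_time_upto M F T (\<rho> n)) \<and>
        (\<forall>n. \<forall>\<omega>\<in>space M. \<rho> n \<omega> \<le> \<rho> (Suc n) \<omega>) \<and>
        (AE \<omega> in M. eventually (\<lambda>n. \<rho> n \<omega> = T) sequentially) \<and>
        (\<forall>n. martingale M F T (\<lambda>t \<omega>. X (min (\<rho> n \<omega>) t) \<omega> - X 0 \<omega>)))"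

text \<open>
  Local martingales are required to be continuous only almost surely: a cadlag process may be
  changed on a null set without losing adaptedness, so requiring it for every path would exclude
  almost every stochastic basis.
\<close>

locale stochastic_basis = prob_space M + complete_measure M + filtration "space M" F
  for M :: "'a measure" and F :: "real \<Rightarrow> 'a measure" +
  fixes T :: real
  assumes T_pos: "0 < T"
    and right_continuous_F: "\<And>t. 0 \<le> t \<Longrightarrow> t < T \<Longrightarrow> sets (F t) = (\<Inter>s\<in>{t<..T}. sets (F s))"
    and null_sets_F0: "null_sets M \<subseteq> sets (F 0)"
    and sets_FT: "sets (F T) = sets M"
    and local_martingales_continuous:
      "\<And>X. local_martingale M F T X \<Longrightarrow> (AE \<omega> in M. continuous_on {0..T} (\<lambda>t. X t \<omega>))"

definition bmo_bound ::
    "'a measure \<Rightarrow> (real \<Rightarrow> 'a measure) \<Rightarrow> real \<Rightarrow> (real \<Rightarrow> 'a \<Rightarrow> real) \<Rightarrow> real \<Rightarrow> bool" where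
  "bmo_bound M F T X c \<longleftrightarrow>
     (\<forall>\<tau>. stopping_time_upto M F T \<tau> \<longrightarrow>
        (AE \<omega> in M. nn_cond_exp M (filtration.pre_sigma (space M) F \<tau>)
           (\<lambda>\<omega>. ennreal (\<bar>X T \<omega> - X (\<tau> \<omega>) \<omega>\<bar> ^ 2)) \<omega> \<le> ennreal (c ^ 2)))"

definition bmo_martingale ::
    "'a measure \<Rightarrow> (real \<Rightarrow> 'a measure) \<Rightarrow> real \<Rightarrow> (real \<Rightarrow> 'a \<Rightarrow> real) \<Rightarrow> bool" where
  "bmo_martingale M F T X \<longleftrightarrow>
     martingale M F T X \<and> continuous_paths M T X \<and> (\<forall>\<omega>\<in>space M. X 0 \<omega> = 0) \<and>
     (\<exists>c>0. bmo_bound M F T X c)"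

text \<open>
  Real-valued, hence meaningful only for BMO-martingales. It is applied only to such processes,
  since the pieces \<open>stopped_increment X \<sigma> \<tau>\<close> of a BMO-martingale are again BMO-martingales.
\<close>

definition bmo_norm ::
    "'a measure \<Rightarrow> (real \<Rightarrow> 'a measure) \<Rightarrow> real \<Rightarrow> (real \<Rightarrow> 'a \<Rightarrow> real) \<Rightarrow> real" where
  "bmo_norm M F T X = Inf {c. 0 < c \<and> bmo_bound M F T X c}"

definition stopped_increment ::
    "(real \<Rightarrow> 'a \<Rightarrow> real) \<Rightarrow> ('a \<Rightarrow> real) \<Rightarrow> ('a \<Rightarrow> real) \<Rightarrow> real \<Rightarrow> 'a \<Rightarrow> real" where
  "stopped_increment X \<sigma> \<tau> t \<omega> = X (min (\<tau> \<omega>) t) \<omega> - X (min (\<sigma> \<omega>) t) \<omega>"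

definition sliceable_number ::
    "'a measure \<Rightarrow> (real \<Rightarrow> 'a measure) \<Rightarrow> real \<Rightarrow> nat \<Rightarrow> (real \<Rightarrow> 'a \<Rightarrow> real) \<Rightarrow> real" where
  "sliceable_number M F T N X =
     Inf {\<epsilon>. 0 < \<epsilon> \<and>
       (\<exists>\<tau> :: nat \<Rightarrow> 'a \<Rightarrow> real.
          (\<forall>k\<le>N. stopping_time_upto M F T (\<tau> k)) \<and>
          (\<forall>\<omega>\<in>space M. \<tau> 0 \<omega> = 0 \<and> \<tau> N \<omega> = T \<and> (\<forall>k<N. \<tau> k \<omega> \<le> \<tau> (Suc k) \<omega>)) \<and>
          (SUP k\<in>{1..N}. bmo_norm M F T (stopped_increment X (\<tau> (k - 1)) (\<tau> k))) \<le> \<epsilon>)}"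

text \<open>
  The bracket \<open>\<langle>X\<rangle>\<close> of a continuous local martingale is unique only up to indistinguishability, so it
  is rendered as a relation: \<open>is_bracket M F T X Q\<close> says that \<open>Q\<close> is a version of \<open>\<langle>X\<rangle>\<close>.
\<close>

definition is_bracket ::
    "'a measure \<Rightarrow> (real \<Rightarrow> 'a measure) \<Rightarrow> real \<Rightarrow>
     (real \<Rightarrow> 'a \<Rightarrow> real) \<Rightarrow> (real \<Rightarrow> 'a \<Rightarrow> real) \<Rightarrow> bool" where
  "is_bracket M F T X Q \<longleftrightarrow>
     adapted F T Q \<and> continuous_paths M T Q \<and>
     (\<forall>\<omega>\<in>space M. Q 0 \<omega> = 0 \<and> mono_on {0..T} (\<lambda>t. Q t \<omega>)) \<and>
     local_martingale M F T (\<lambda>t \<omega>. (X t \<omega>)\<^sup>2 - Q t \<omega>)"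

text \<open>\<open>stoch_exp X \<langle>X\<rangle>\<close> is the stochastic exponential of \<open>X\<close>.\<close>

definition stoch_exp ::
    "(real \<Rightarrow> 'a \<Rightarrow> real) \<Rightarrow> (real \<Rightarrow> 'a \<Rightarrow> real) \<Rightarrow> real \<Rightarrow> 'a \<Rightarrow> real" where
  "stoch_exp X Q t \<omega> = exp (X t \<omega> - 1 / 2 * Q t \<omega>)"

text \<open>Powers with positive exponent on \<open>[0,\<infinity>]\<close>.\<close>

definition ennreal_powr :: "ennreal \<Rightarrow> real \<Rightarrow> ennreal" where
  "ennreal_powr x p = (if x = \<infinity> then \<infinity> else ennreal (enn2real x powr p))"

text \<open>
  The infimum over the empty set is \<open>\<infinity>\<close>; otherwise it is attained, because a countable
  intersection of events of full measure has full measure.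
\<close>

definition reverse_Hoelder ::
    "'a measure \<Rightarrow> (real \<Rightarrow> 'a measure) \<Rightarrow> real \<Rightarrow> real \<Rightarrow> (real \<Rightarrow> 'a \<Rightarrow> real) \<Rightarrow> ennreal" where
  "reverse_Hoelder M F T \<beta> Z =
     Inf (ennreal ` {c. 0 \<le> c \<and>
       (\<forall>\<tau>. stopping_time_upto M F T \<tau> \<longrightarrow>
          (AE \<omega> in M.
             ennreal_powr (nn_cond_exp M (filtration.pre_sigma (space M) F \<tau>)
               (\<lambda>\<omega>. ennreal (\<bar>Z T \<omega>\<bar> powr \<beta>)) \<omega>) (1 / \<beta>)
             \<le> ennreal (c * Z (\<tau> \<omega>) \<omega>)))})"

end

theory Submission
  imports Defs
begin

text \<open>
  Fix a slicing \<open>0 = \<tau>\<^sub>0 \<le> \<dots> \<le> \<tau>\<^sub>N = T\<close> and a stopping time \<open>\<rho>\<close>, and put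
  \<open>\<theta>\<^sub>k = max \<rho> \<tau>\<^sub>k\<close>. The ratio of the stochastic exponential at \<open>\<theta>\<^sub>k\<close> and \<open>\<theta>\<^sub>k\<^sub>-\<^sub>1\<close> equals the
  ratio of the stochastic exponential of the \<open>k\<close>-th slice at \<open>T\<close> and \<open>\<theta>\<^sub>k\<^sub>-\<^sub>1\<close>, so that conditioning
  successively on \<open>\<theta>\<^sub>N, \<dots>, \<theta>\<^sub>0 = \<rho>\<close> costs one factor \<open>\<Psi>(\<epsilon>,\<beta>)\<close> per slice. Right-continuity of
  \<open>\<Psi>\<close> lets \<open>\<epsilon>\<close> decrease to the sliceable number.

  The hypothesis applies to the slices because they are BMO-martingales whose brackets are the
  slices of the bracket. Both facts rest on optional stopping: a continuous adapted process is a
  martingale iff its mean is the same at all stopping times.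
\<close>

text \<open>Two separate demands are made on a slice. It must be a BMO-martingale with a known
  bracket, because the hypothesis on \<Phi> and \<Psi> speaks about nothing else; for this a crude
  BMO constant, twice that of the whole martingale, is enough and never reaches the final estimate.
  Its norm must be small, and this comes directly from the slicing. The obstacle in chaining the
  slices is that the conditioning time \<rho> may fall inside one of them. Taking maxima with \<rho>
  collapses the slices that end before \<rho> and lets the one containing \<rho> start there. This
  is harmless because the reverse Hoelder inequality of a slice holds at every stopping time, not
  only at the start of the slice. Both the sliceable number and the reverse Hoelder constant are
  infima. Attainment is avoided by working with an arbitrary \<open>c\<close> strictly above
  \<Psi>(s,\<beta>), where s is the sliceable number: strictness leaves room for a slicing slightly
  worse than optimal and for a constant slightly above the infimum.\<close>

lemma subalgebra_pre_sigma_mono: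
  assumes "filtration \<Omega> F" "stopping_time F \<sigma>" "stopping_time F \<tau>"
    "\<And>\<omega>. \<omega> \<in> \<Omega> \<Longrightarrow> \<sigma> \<omega> \<le> \<tau> \<omega>"
  shows "subalgebra (filtration.pre_sigma \<Omega> F \<tau>) (filtration.pre_sigma \<Omega> F \<sigma>)"
  using filtration.mono_pre_sigma[OF assms(1-3)] assms(4)
  by (auto simp: subalgebra_def filtration.space_pre_sigma[OF assms(1)])

text \<open>Rounding goes up, since rounding a stopping time down would look into the future. The
  endpoint \<open>u\<close> is itself a grid point, so the interval from 0 to \<open>u\<close> is
  mapped into itself.\<close>

definition grid :: "real \<Rightarrow> nat \<Rightarrow> real \<Rightarrow> real" where
  "grid u n x = u * of_int \<lceil>real (Suc n) * x / u\<rceil> / real (Suc n)"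

lemma
  assumes "0 < u" "0 \<le> x" "x \<le> u"
  shows grid_ge: "x \<le> grid u n x"
    and grid_le: "grid u n x \<le> u"
    and grid_less: "grid u n x < x + u / real (Suc n)"
    and grid_cases: "\<exists>i\<le>Suc n. grid u n x = u * real i / real (Suc n)"
proof -
  let ?y = "real (Suc n) * x / u"
  have "x = u * ?y / real (Suc n)" using assms by (simp del: of_nat_Suc)
  also have "\<dots> \<le> grid u n x"
    unfolding grid_def using assms by (intro divide_right_mono mult_left_mono) auto
  finally show "x \<le> grid u n x" .
  have "u * of_int \<lceil>?y\<rceil> / real (Suc n) < u * (?y + 1) / real (Suc n)"
    using assms by (intro divide_strict_right_mono mult_strict_left_mono) (auto, linarith)
  also have "\<dots> = x + u / real (Suc n)"
    using assms by (simp add: distrib_left add_divide_distrib del: of_nat_Suc)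
  finally show "grid u n x < x + u / real (Suc n)" unfolding grid_def .
  have "?y \<le> real (Suc n)"
    using assms mult_left_mono[of x u "real (Suc n)"] by (simp add: divide_le_eq del: of_nat_Suc)
  then have "\<lceil>?y\<rceil> \<le> int (Suc n)" by (simp only: ceiling_le_iff of_int_of_nat_eq)
  moreover have "0 \<le> \<lceil>?y\<rceil>"
  proof -
    have "0 \<le> ?y" using assms by simp
    then show ?thesis by linarith
  qed
  ultimately have "grid u n x = u * real (nat \<lceil>?y\<rceil>) / real (Suc n)" "nat \<lceil>?y\<rceil> \<le> Suc n"
    by (simp_all add: grid_def nat_le_iff del: of_nat_Suc)
  then show *: "\<exists>i\<le>Suc n. grid u n x = u * real i / real (Suc n)" by blast
  then obtain i where "i \<le> Suc n" "grid u n x = u * real i / real (Suc n)" by blast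
  moreover have "u * real i \<le> u * real (Suc n)" using \<open>i \<le> Suc n\<close> assms by (intro mult_left_mono) auto
  ultimately show "grid u n x \<le> u" by (simp add: divide_le_eq)
qed

lemma grid_tendsto:
  assumes "0 < u" "0 \<le> x" "x \<le> u"
  shows "(\<lambda>n. grid u n x) \<longlonglongrightarrow> x"
proof (rule tendsto_sandwich)
  show "\<forall>\<^sub>F n in sequentially. x \<le> grid u n x" "\<forall>\<^sub>F n in sequentially. grid u n x \<le> x + u / real (Suc n)"
    by (intro always_eventually allI grid_ge less_imp_le[OF grid_less] assms)+
  show "(\<lambda>n. x + u / real (Suc n)) \<longlonglongrightarrow> x"
    using tendsto_add[OF tendsto_const LIMSEQ_Suc[OF lim_const_over_n[of u]], of x] by simp
qed simp

text \<open>Ceiling and floor are adjoint. The right side compares the unrounded value with the last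
  grid point not after \<open>t\<close>, a deterministic time; this is why rounding up preserves
  stopping times.\<close>

lemma grid_le_iff:
  assumes "0 < u"
  shows "grid u n x \<le> t \<longleftrightarrow> x \<le> u * of_int \<lfloor>real (Suc n) * t / u\<rfloor> / real (Suc n)"
proof -
  have "grid u n x \<le> t \<longleftrightarrow> of_int \<lceil>real (Suc n) * x / u\<rceil> \<le> real (Suc n) * t / u"
    using assms unfolding grid_def by (simp add: field_simps)
  also have "\<dots> \<longleftrightarrow> real (Suc n) * x / u \<le> of_int \<lfloor>real (Suc n) * t / u\<rfloor>"
    by (simp add: le_floor_iff[symmetric] ceiling_le_iff del: of_nat_Suc)
  also have "\<dots> \<longleftrightarrow> x \<le> u * of_int \<lfloor>real (Suc n) * t / u\<rfloor> / real (Suc n)"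
    using assms by (simp add: field_simps)
  finally show ?thesis .
qed

text \<open>Removes the root from the definition of \<open>reverse_Hoelder\<close>, so that
  conditional expectations can be compared and multiplied directly. For infinite \<open>x\<close>
  both sides are false.\<close>

lemma ennreal_powr_inverse_le_iff:
  assumes "0 < \<beta>" "0 \<le> y"
  shows "ennreal_powr x (1 / \<beta>) \<le> ennreal y \<longleftrightarrow> x \<le> ennreal (y powr \<beta>)"
proof (cases x)
  case (real r)
  have "r powr (1 / \<beta>) \<le> y \<longleftrightarrow> (r powr (1 / \<beta>)) powr \<beta> \<le> y powr \<beta>"
    using assms powr_mono2[of \<beta> "r powr (1 / \<beta>)" y] powr_less_mono2[of \<beta> y "r powr (1 / \<beta>)"]
    by (auto simp: not_le[symmetric])
  also have "(r powr (1 / \<beta>)) powr \<beta> = r" using assms real by (simp add: powr_powr)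
  finally show ?thesis using real assms by (simp add: ennreal_powr_def)
qed (simp add: ennreal_powr_def top_unique)

section \<open>Stopping times and sampling of continuous adapted processes\<close>

context stochastic_basis
begin

abbreviation stopping :: "('a \<Rightarrow> real) \<Rightarrow> bool" where
  "stopping \<equiv> stopping_time_upto M F T"

text \<open>The class for which values at stopping times are measurable. It covers brackets and
  stochastic exponentials, which carry no integrability assumption, as well as martingales.\<close>

definition regular :: "(real \<Rightarrow> 'a \<Rightarrow> real) \<Rightarrow> bool" where
  "regular X \<longleftrightarrow> adapted F T X \<and> continuous_paths M T X"

lemma stoppingD:
  assumes "stopping \<tau>"
  shows "stopping_time F \<tau>" "\<omega> \<in> space M \<Longrightarrow> 0 \<le> \<tau> \<omega>" "\<omega> \<in> space M \<Longrightarrow> \<tau> \<omega> \<le> T"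
  using assms by (auto simp: stopping_time_upto_def)

lemma stopping_const: "0 \<le> c \<Longrightarrow> c \<le> T \<Longrightarrow> stopping (\<lambda>_. c)"
  by (simp add: stopping_time_upto_def stopping_time_const)

lemma stopping_min: "stopping \<sigma> \<Longrightarrow> stopping \<tau> \<Longrightarrow> stopping (\<lambda>\<omega>. min (\<sigma> \<omega>) (\<tau> \<omega>))"
  by (auto simp: stopping_time_upto_def stopping_time_min)

lemma stopping_max: "stopping \<sigma> \<Longrightarrow> stopping \<tau> \<Longrightarrow> stopping (\<lambda>\<omega>. max (\<sigma> \<omega>) (\<tau> \<omega>))"
  by (auto simp: stopping_time_upto_def stopping_time_max)

lemma subalgebra_F: "t \<le> T \<Longrightarrow> subalgebra M (F t)"
  using sets_F_mono[of t T] sets_FT by (auto simp: subalgebra_def space_F)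

lemma subalgebra_F_mono: "s \<le> t \<Longrightarrow> subalgebra (F t) (F s)"
  using sets_F_mono[of s t] by (auto simp: subalgebra_def space_F)

text \<open>As \<tau> is bounded by \<open>T\<close>, every event of \<open>pre_sigma \<tau>\<close>
  is its own trace on \<tau> \<le> T and hence lies in \<open>F T\<close>.\<close>

lemma subalgebra_pre_sigma: "stopping \<tau> \<Longrightarrow> subalgebra M (pre_sigma \<tau>)"
proof -
  assume \<tau>: "stopping \<tau>"
  have "A \<in> sets M" if A: "A \<in> sets (pre_sigma \<tau>)" for A
  proof -
    have "A \<subseteq> space M" using sets.sets_into_space[OF A] by (simp add: space_pre_sigma)
    then have "{\<omega>\<in>A. \<tau> \<omega> \<le> T} = A" using stoppingD(3)[OF \<tau>] by auto
    then show ?thesis using sets_pre_sigmaD[OF stoppingD(1)[OF \<tau>] A, of T] sets_FT by simp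
  qed
  then show ?thesis by (auto simp: subalgebra_def space_pre_sigma)
qed

lemma sigma_finite_subalgebraI: "subalgebra M G \<Longrightarrow> sigma_finite_subalgebra M G"
  by (intro finite_measure_subalgebra_is_sigma_finite)
    (simp add: finite_measure_subalgebra_def finite_measure_subalgebra_axioms_def finite_measure_axioms)

lemma subalgebra_pre_sigma_le:
  assumes "stopping \<sigma>" "stopping \<tau>" "\<And>\<omega>. \<omega> \<in> space M \<Longrightarrow> \<sigma> \<omega> \<le> \<tau> \<omega>"
  shows "subalgebra (pre_sigma \<tau>) (pre_sigma \<sigma>)"
  using subalgebra_pre_sigma_mono[OF filtration_axioms] assms stoppingD(1) by blast

lemma stopping_grid:
  assumes "stopping \<tau>"
  shows "stopping (\<lambda>\<omega>. grid T n (\<tau> \<omega>))"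
  unfolding stopping_time_upto_def
proof (intro conjI ballI stopping_timeI)
  fix t
  have *: "T * of_int \<lfloor>real (Suc n) * t / T\<rfloor> / real (Suc n) \<le> t"
  proof -
    have "T * of_int \<lfloor>real (Suc n) * t / T\<rfloor> / real (Suc n) \<le> T * (real (Suc n) * t / T) / real (Suc n)"
      using T_pos by (intro divide_right_mono mult_left_mono of_int_floor_le) auto
    then show ?thesis using T_pos by (simp del: of_nat_Suc)
  qed
  show "Measurable.pred (F t) (\<lambda>\<omega>. grid T n (\<tau> \<omega>) \<le> t)"
    unfolding grid_le_iff[OF T_pos] by (rule stopping_time_le_const[OF stoppingD(1)[OF assms] *])
next
  fix \<omega> assume \<omega>: "\<omega> \<in> space M"
  show "0 \<le> grid T n (\<tau> \<omega>)" "grid T n (\<tau> \<omega>) \<le> T"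
    using grid_ge[OF T_pos stoppingD(2,3)[OF assms \<omega>], of n] grid_le[OF T_pos stoppingD(2,3)[OF assms \<omega>]]
      stoppingD(2)[OF assms \<omega>] by auto
qed

text \<open>The device that turns statements about means at stopping times into statements about
  integrals over events known at \<sigma>.\<close>

lemma stopping_if:
  assumes \<sigma>: "stopping \<sigma>" and \<tau>: "stopping \<tau>" and le: "\<And>\<omega>. \<omega> \<in> space M \<Longrightarrow> \<sigma> \<omega> \<le> \<tau> \<omega>"
    and A: "A \<in> sets (pre_sigma \<sigma>)"
  shows "stopping (\<lambda>\<omega>. if \<omega> \<in> A then \<sigma> \<omega> else \<tau> \<omega>)"
  unfolding stopping_time_upto_def
proof (intro conjI ballI stopping_timeI)
  fix t
  have AM: "A \<subseteq> space M" using sets.sets_into_space[OF A] by (simp add: space_pre_sigma)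
  have [measurable]: "{\<omega>\<in>A. \<sigma> \<omega> \<le> t} \<in> sets (F t)"
    by (rule sets_pre_sigmaD[OF stoppingD(1)[OF \<sigma>] A])
  have [measurable]: "{\<omega>\<in>space M. \<tau> \<omega> \<le> t} \<in> sets (F t)"
    using stopping_timeD[OF stoppingD(1)[OF \<tau>], of t] by (simp add: pred_def space_F)
  \<comment> \<open>Where \<tau> \<le> t also \<sigma> \<le> t, so subtracting the part of
    \<open>A\<close> with \<sigma> \<le> t removes exactly the points of \<open>A\<close>. Thus only
    events known to lie in \<open>F t\<close> occur.\<close>
  have "{\<omega> \<in> space M. (if \<omega> \<in> A then \<sigma> \<omega> else \<tau> \<omega>) \<le> t} =
      {\<omega>\<in>A. \<sigma> \<omega> \<le> t} \<union> ({\<omega>\<in>space M. \<tau> \<omega> \<le> t} - {\<omega>\<in>A. \<sigma> \<omega> \<le> t})"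
    using le AM by (auto intro: order_trans)
  then show "Measurable.pred (F t) (\<lambda>\<omega>. (if \<omega> \<in> A then \<sigma> \<omega> else \<tau> \<omega>) \<le> t)"
    by (simp add: pred_def space_F)
qed (use stoppingD[OF \<sigma>] stoppingD[OF \<tau>] in auto)

lemma path_tendsto:
  assumes "continuous_paths M T X" "\<omega> \<in> space M" "f \<longlonglongrightarrow> x" "0 \<le> x" "x \<le> T"
    "\<And>n. 0 \<le> f n" "\<And>n. f n \<le> T"
  shows "(\<lambda>n. X (f n) \<omega>) \<longlonglongrightarrow> X x \<omega>"
  using assms continuous_on_tendsto_compose[of "{0..T}" "\<lambda>t. X t \<omega>" f x sequentially]
  by (auto simp: continuous_paths_def)

text \<open>Progressive measurability in disguise: \<open>f\<close> is approximated from above on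
  the grid of the interval up to \<open>u\<close>. The grid depends on \<open>u\<close> and not on
  \<open>T\<close>, so every sampled time stays below \<open>u\<close> and every sampled variable in
  \<open>F u\<close>. The case \<open>u = 0\<close> is separate because the grid divides by
  \<open>u\<close>.\<close>

lemma regular_sample_measurable:
  assumes X: "regular X" and u: "0 \<le> u" "u \<le> T" and f: "f \<in> borel_measurable (F u)"
    and bd: "\<And>\<omega>. \<omega> \<in> space M \<Longrightarrow> 0 \<le> f \<omega> \<and> f \<omega> \<le> u"
  shows "(\<lambda>\<omega>. X (f \<omega>) \<omega>) \<in> borel_measurable (F u)"
proof (cases "u = 0")
  case True
  then have "\<And>\<omega>. \<omega> \<in> space (F u) \<Longrightarrow> X (f \<omega>) \<omega> = X 0 \<omega>" using bd by (force simp: space_F)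
  moreover have "X 0 \<in> borel_measurable (F u)" using X u True T_pos by (simp add: regular_def adapted_def)
  ultimately show ?thesis by (simp cong: measurable_cong)
next
  case False
  with u have u0: "0 < u" by simp
  let ?d = "\<lambda>n i. u * real i / real (Suc n)"
  show ?thesis
  proof (rule borel_measurable_LIMSEQ_real)
    fix \<omega> assume "\<omega> \<in> space (F u)"
    then have \<omega>: "\<omega> \<in> space M" by (simp add: space_F)
    note b = bd[OF \<omega>]
    show "(\<lambda>n. X (grid u n (f \<omega>)) \<omega>) \<longlonglongrightarrow> X (f \<omega>) \<omega>"
      using X b u grid_ge[OF u0, of "f \<omega>"] grid_le[OF u0, of "f \<omega>"]
      by (intro path_tendsto[OF _ \<omega> grid_tendsto[OF u0]]) (auto simp: regular_def intro: order_trans)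
  next
    fix n
    have [measurable]: "X (?d n i) \<in> borel_measurable (F u)" if "i \<le> Suc n" for i
    proof -
      have "u * real i \<le> u * real (Suc n)" using that u by (intro mult_left_mono) auto
      then have "?d n i \<le> u" by (simp add: divide_le_eq)
      moreover have "X (?d n i) \<in> borel_measurable (F (?d n i))"
        using X u order_trans[OF \<open>?d n i \<le> u\<close>] by (simp add: regular_def adapted_def del: of_nat_Suc)
      ultimately show ?thesis
        by (rule measurable_from_subalg[OF subalgebra_F_mono])
    qed
    have [measurable]: "(\<lambda>\<omega>. grid u n (f \<omega>)) \<in> borel_measurable (F u)"
      unfolding grid_def using f by measurable
    \<comment> \<open>The grid points are pairwise distinct, so exactly one summand survives and
      equals the sampled value.\<close>
    have "(\<lambda>\<omega>. \<Sum>i\<le>Suc n. if grid u n (f \<omega>) = ?d n i then X (?d n i) \<omega> else 0) \<in> borel_measurable (F u)"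
      by (intro borel_measurable_sum) (auto intro!: measurable_If)
    also have "?this \<longleftrightarrow> (\<lambda>\<omega>. X (grid u n (f \<omega>)) \<omega>) \<in> borel_measurable (F u)"
    proof (rule measurable_cong)
      fix \<omega> assume "\<omega> \<in> space (F u)"
      then have \<omega>: "\<omega> \<in> space M" by (simp add: space_F)
      from grid_cases[OF u0, of "f \<omega>" n] bd[OF \<omega>]
      obtain j where j: "j \<le> Suc n" "grid u n (f \<omega>) = ?d n j" by auto
      have "(\<Sum>i\<le>Suc n. if grid u n (f \<omega>) = ?d n i then X (?d n i) \<omega> else 0) =
          (\<Sum>i\<le>Suc n. if i = j then X (?d n i) \<omega> else 0)"
        using u0 by (intro sum.cong) (auto simp: j)
      also have "\<dots> = X (grid u n (f \<omega>)) \<omega>" using j by (simp del: of_nat_Suc sum.atMost_Suc)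
      finally show "(\<Sum>i\<le>Suc n. if grid u n (f \<omega>) = ?d n i then X (?d n i) \<omega> else 0) = X (grid u n (f \<omega>)) \<omega>" .
    qed
    finally show "(\<lambda>\<omega>. X (grid u n (f \<omega>)) \<omega>) \<in> borel_measurable (F u)" .
  qed
qed

lemma regular_stopped_measurable:
  assumes X: "regular X" and \<tau>: "stopping \<tau>" and t: "0 \<le> t" "t \<le> T"
  shows "(\<lambda>\<omega>. X (min (\<tau> \<omega>) t) \<omega>) \<in> borel_measurable (F t)"
proof (rule regular_sample_measurable[OF X t])
  show "(\<lambda>\<omega>. min (\<tau> \<omega>) t) \<in> borel_measurable (F t)"
  proof (rule borel_measurableI_le)
    fix y
    \<comment> \<open>The threshold \<open>min y t\<close> never exceeds \<open>t\<close>, so the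
      event lies in \<open>F t\<close> for every \<open>y\<close>; for \<open>y\<close> at or above
      \<open>t\<close> the first disjunct already holds.\<close>
    have "Measurable.pred (F t) (\<lambda>\<omega>. t \<le> y \<or> \<tau> \<omega> \<le> min y t)"
      by (intro pred_intros_logic stopping_time_le_const[OF stoppingD(1)[OF \<tau>]]) auto
    also have "(\<lambda>\<omega>. t \<le> y \<or> \<tau> \<omega> \<le> min y t) = (\<lambda>\<omega>. min (\<tau> \<omega>) t \<le> y)" by (auto simp: fun_eq_iff)
    finally show "{\<omega> \<in> space (F t). min (\<tau> \<omega>) t \<le> y} \<in> sets (F t)" by (simp add: pred_def)
  qed
qed (use stoppingD[OF \<tau>] t in auto)

lemma regular_pre_sigma_measurable:
  assumes X: "regular X" and \<tau>: "stopping \<tau>"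
  shows "(\<lambda>\<omega>. X (\<tau> \<omega>) \<omega>) \<in> borel_measurable (pre_sigma \<tau>)"
proof (rule measurableI)
  fix B :: "real set" assume B: "B \<in> sets borel"
  show "(\<lambda>\<omega>. X (\<tau> \<omega>) \<omega>) -` B \<inter> space (pre_sigma \<tau>) \<in> sets (pre_sigma \<tau>)"
  proof (rule sets_pre_sigmaI[OF stoppingD(1)[OF \<tau>]])
    fix t
    show "{\<omega> \<in> (\<lambda>\<omega>. X (\<tau> \<omega>) \<omega>) -` B \<inter> space (pre_sigma \<tau>). \<tau> \<omega> \<le> t} \<in> sets (F t)" (is "?S \<in> _")
    proof (cases "t < 0")
      case True
      then have "?S = {}" using stoppingD(2)[OF \<tau>] by (force simp: space_pre_sigma)
      then show ?thesis by (simp only: sets.empty_sets)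
    next
      case False
      \<comment> \<open>Membership in \<open>pre_sigma\<close> is tested at all real
        \<open>t\<close>, while the process is controlled only up to \<open>T\<close>. As \<tau>
        \<le> T, capping the time at \<open>T\<close> does not change the sampled value on \<tau>
        \<le> t.\<close>
      let ?u = "min t T"
      have u: "0 \<le> ?u" "?u \<le> T" "?u \<le> t" using False T_pos by auto
      have m: "(\<lambda>\<omega>. X (min (\<tau> \<omega>) ?u) \<omega>) \<in> borel_measurable (F t)"
        using measurable_from_subalg[OF subalgebra_F_mono[OF u(3)] regular_stopped_measurable[OF X \<tau> u(1,2)]] .
      have "?S = ((\<lambda>\<omega>. X (min (\<tau> \<omega>) ?u) \<omega>) -` B \<inter> space (F t)) \<inter> {\<omega> \<in> space (F t). \<tau> \<omega> \<le> t}"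
        using stoppingD(3)[OF \<tau>] by (auto simp: space_pre_sigma space_F min_def)
      also have "\<dots> \<in> sets (F t)"
        using measurable_sets[OF m B] stopping_timeD[OF stoppingD(1)[OF \<tau>], of t]
        by (auto simp: pred_def)
      finally show ?thesis .
    qed
  qed
qed simp

lemma regular_measurable:
  assumes "regular X" "stopping \<tau>"
  shows "(\<lambda>\<omega>. X (\<tau> \<omega>) \<omega>) \<in> borel_measurable M"
  using measurable_from_subalg[OF subalgebra_pre_sigma regular_pre_sigma_measurable] assms by blast

section \<open>Optional stopping for continuous martingales\<close>

text \<open>On the event \<tau> = d, which lies in \<open>F d\<close>, Jensen's inequality compares
  \<open>q (X d)\<close> with the conditional expectation of \<open>q (X T)\<close>; then sum over
  \<open>d\<close>. A general convex \<open>q\<close> serves two purposes in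
  \<open>optional_stopping\<close>: linear functions give the mean, excess functions give uniform
  integrability.\<close>

lemma finite_sampling_convex:
  fixes q :: "real \<Rightarrow> real"
  assumes mart: "martingale M F T X" and \<tau>: "stopping \<tau>"
    and D: "finite D" "D \<subseteq> {0..T}" "\<And>\<omega>. \<omega> \<in> space M \<Longrightarrow> \<tau> \<omega> \<in> D"
    and q: "convex_on UNIV q" "q \<in> borel_measurable borel" "integrable M (\<lambda>\<omega>. q (X T \<omega>))"
  shows "integrable M (\<lambda>\<omega>. q (X (\<tau> \<omega>) \<omega>))"
    and "(\<integral>\<omega>. q (X (\<tau> \<omega>) \<omega>) \<partial>M) \<le> (\<integral>\<omega>. q (X T \<omega>) \<partial>M)"
proof -
  have XT: "integrable M (X T)" using mart T_pos by (auto simp: martingale_def)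
  have int: "integrable M (\<lambda>\<omega>. indicator {\<omega>. \<tau> \<omega> = d} \<omega> * q (X d \<omega>))"
    and int': "integrable M (\<lambda>\<omega>. indicator {\<omega>. \<tau> \<omega> = d} \<omega> * q (X T \<omega>))"
    and le: "(\<integral>\<omega>. indicator {\<omega>. \<tau> \<omega> = d} \<omega> * q (X d \<omega>) \<partial>M) \<le> (\<integral>\<omega>. indicator {\<omega>. \<tau> \<omega> = d} \<omega> * q (X T \<omega>) \<partial>M)"
    if d: "d \<in> D" for d
  proof -
    have dT: "0 \<le> d" "d \<le> T" using D d by auto
    interpret sigma_finite_subalgebra M "F d"
      by (rule sigma_finite_subalgebraI[OF subalgebra_F[OF dT(2)]])
    let ?E = "real_cond_exp M (F d)"
    have Xd: "AE \<omega> in M. ?E (X T) \<omega> = X d \<omega>" using mart dT by (auto simp: martingale_def)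
    have [measurable]: "X d \<in> borel_measurable M" "q \<in> borel_measurable borel"
      using mart dT q by (auto simp: martingale_def)
    have A: "(indicator {\<omega>. \<tau> \<omega> = d} :: _ \<Rightarrow> real) \<in> borel_measurable (F d)"
      using stopping_time_eq_const[OF stoppingD(1)[OF \<tau>], of d]
      by (simp add: pred_def borel_measurable_indicator_iff Int_def conj_commute)
    note A' [measurable] = measurable_from_subalg[OF subalgebra_F[OF dT(2)] A]
    have "integrable M (\<lambda>\<omega>. q (?E (X T) \<omega>))"
      by (rule integrable_convex_cond_exp[OF XT _ _ q(3,1,2)]) (auto simp: emeasure_space_1)
    then have i: "integrable M (\<lambda>\<omega>. q (X d \<omega>))"
    proof (rule integrable_cong_AE_imp)
      show "AE \<omega> in M. q (?E (X T) \<omega>) = q (X d \<omega>)" using Xd by eventually_elim simp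
    qed simp
    show *: "integrable M (\<lambda>\<omega>. indicator {\<omega>. \<tau> \<omega> = d} \<omega> * q (X d \<omega>))"
      by (rule Bochner_Integration.integrable_bound[OF i]) (auto split: split_indicator)
    show **: "integrable M (\<lambda>\<omega>. indicator {\<omega>. \<tau> \<omega> = d} \<omega> * q (X T \<omega>))"
      by (rule Bochner_Integration.integrable_bound[OF q(3)]) (use q(3) in \<open>auto split: split_indicator\<close>)
    have "AE \<omega> in M. q (?E (X T) \<omega>) \<le> ?E (\<lambda>\<omega>. q (X T \<omega>)) \<omega>"
      by (rule real_cond_exp_jensens_inequality(2)[OF XT _ _ q(3,1,2)]) auto
    with Xd have "AE \<omega> in M. indicator {\<omega>. \<tau> \<omega> = d} \<omega> * q (X d \<omega>)
        \<le> indicator {\<omega>. \<tau> \<omega> = d} \<omega> * ?E (\<lambda>\<omega>. q (X T \<omega>)) \<omega>"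
      by eventually_elim (auto simp: indicator_def)
    then have "(\<integral>\<omega>. indicator {\<omega>. \<tau> \<omega> = d} \<omega> * q (X d \<omega>) \<partial>M)
        \<le> (\<integral>\<omega>. indicator {\<omega>. \<tau> \<omega> = d} \<omega> * ?E (\<lambda>\<omega>. q (X T \<omega>)) \<omega> \<partial>M)"
      using q(3) by (intro integral_mono_AE * real_cond_exp_intg(1) ** A) auto
    also have "\<dots> = (\<integral>\<omega>. indicator {\<omega>. \<tau> \<omega> = d} \<omega> * q (X T \<omega>) \<partial>M)"
      using q(3) by (intro real_cond_exp_intg(2) ** A) auto
    finally show "(\<integral>\<omega>. indicator {\<omega>. \<tau> \<omega> = d} \<omega> * q (X d \<omega>) \<partial>M) \<le> (\<integral>\<omega>. indicator {\<omega>. \<tau> \<omega> = d} \<omega> * q (X T \<omega>) \<partial>M)" .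
  qed
  have ind: "(\<Sum>d\<in>D. indicator {\<omega>. \<tau> \<omega> = d} \<omega> * f d) = f (\<tau> \<omega>)" if "\<omega> \<in> space M" for \<omega> and f :: "real \<Rightarrow> real"
  proof -
    have "(\<Sum>d\<in>D. indicator {\<omega>. \<tau> \<omega> = d} \<omega> * f d) = (\<Sum>d\<in>D. if \<tau> \<omega> = d then f d else 0)"
      by (intro sum.cong) (auto simp: indicator_def)
    then show ?thesis using D that by simp
  qed
  have "integrable M (\<lambda>\<omega>. \<Sum>d\<in>D. indicator {\<omega>. \<tau> \<omega> = d} \<omega> * q (X d \<omega>))"
    using int by auto
  then show "integrable M (\<lambda>\<omega>. q (X (\<tau> \<omega>) \<omega>))"
    by (simp add: ind cong: Bochner_Integration.integrable_cong)
  have "(\<integral>\<omega>. q (X (\<tau> \<omega>) \<omega>) \<partial>M) = (\<integral>\<omega>. (\<Sum>d\<in>D. indicator {\<omega>. \<tau> \<omega> = d} \<omega> * q (X d \<omega>)) \<partial>M)"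
    by (simp add: ind cong: Bochner_Integration.integral_cong)
  also have "\<dots> = (\<Sum>d\<in>D. \<integral>\<omega>. indicator {\<omega>. \<tau> \<omega> = d} \<omega> * q (X d \<omega>) \<partial>M)"
    using int by (intro Bochner_Integration.integral_sum)
  also have "\<dots> \<le> (\<Sum>d\<in>D. \<integral>\<omega>. indicator {\<omega>. \<tau> \<omega> = d} \<omega> * q (X T \<omega>) \<partial>M)"
    using le by (intro sum_mono)
  also have "\<dots> = (\<integral>\<omega>. (\<Sum>d\<in>D. indicator {\<omega>. \<tau> \<omega> = d} \<omega> * q (X T \<omega>)) \<partial>M)"
    using int' by (intro Bochner_Integration.integral_sum[symmetric])
  also have "\<dots> = (\<integral>\<omega>. q (X T \<omega>) \<partial>M)"
    by (simp add: ind cong: Bochner_Integration.integral_cong)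
  finally show "(\<integral>\<omega>. q (X (\<tau> \<omega>) \<omega>) \<partial>M) \<le> (\<integral>\<omega>. q (X T \<omega>) \<partial>M)" .
qed

lemma grid_sampling_convex:
  fixes q :: "real \<Rightarrow> real"
  assumes mart: "martingale M F T X" and \<tau>: "stopping \<tau>"
    and q: "convex_on UNIV q" "q \<in> borel_measurable borel" "integrable M (\<lambda>\<omega>. q (X T \<omega>))"
  shows "integrable M (\<lambda>\<omega>. q (X (grid T n (\<tau> \<omega>)) \<omega>))"
    and "(\<integral>\<omega>. q (X (grid T n (\<tau> \<omega>)) \<omega>) \<partial>M) \<le> (\<integral>\<omega>. q (X T \<omega>) \<partial>M)"
proof -
  define D where "D = (\<lambda>i. T * real i / real (Suc n)) ` {..Suc n}"
  have fin: "finite D" by (simp add: D_def)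
  have sub: "D \<subseteq> {0..T}"
    using T_pos by (auto simp: D_def divide_le_eq mult_left_mono simp del: of_nat_Suc)
  have mem: "grid T n (\<tau> \<omega>) \<in> D" if "\<omega> \<in> space M" for \<omega>
    using grid_cases[OF T_pos stoppingD(2,3)[OF \<tau> that], of n] by (auto simp: D_def simp del: of_nat_Suc)
  show "integrable M (\<lambda>\<omega>. q (X (grid T n (\<tau> \<omega>)) \<omega>))"
    "(\<integral>\<omega>. q (X (grid T n (\<tau> \<omega>)) \<omega>) \<partial>M) \<le> (\<integral>\<omega>. q (X T \<omega>) \<partial>M)"
    using finite_sampling_convex[OF mart stopping_grid[OF \<tau>] fin sub mem q] by auto
qed

lemma convex_excess: "convex_on UNIV (\<lambda>x::real. max (\<bar>x\<bar> - K) 0)"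
proof (rule convex_onI)
  fix t x y :: real assume t: "0 < t" "t < 1"
  have "\<bar>(1 - t) * x + t * y\<bar> \<le> (1 - t) * \<bar>x\<bar> + t * \<bar>y\<bar>"
    using abs_triangle_ineq[of "(1 - t) * x" "t * y"] t by (simp only: abs_mult abs_of_pos diff_gt_0_iff_gt)
  then have "\<bar>(1 - t) * x + t * y\<bar> - K \<le> (1 - t) * (\<bar>x\<bar> - K) + t * (\<bar>y\<bar> - K)"
    by (simp add: algebra_simps)
  also have "\<dots> \<le> (1 - t) * max (\<bar>x\<bar> - K) 0 + t * max (\<bar>y\<bar> - K) 0"
    using t by (intro add_mono mult_left_mono) auto
  finally show "max (\<bar>(1 - t) *\<^sub>R x + t *\<^sub>R y\<bar> - K) 0 \<le> (1 - t) * max (\<bar>x\<bar> - K) 0 + t * max (\<bar>y\<bar> - K) 0"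
    using t by (auto intro!: add_nonneg_nonneg)
qed simp

text \<open>Jensen's inequality bounds the excesses \<open>(\<bar>X\<^sub>\<sigma>\<bar> - K)\<^sup>+\<close> over the grid approximations \<open>\<sigma>\<close> of
  \<open>\<tau>\<close> by \<open>(\<bar>X\<^sub>T\<bar> - K)\<^sup>+\<close> in the mean, which replaces uniform integrability.\<close>

lemma optional_stopping:
  assumes mart: "martingale M F T X" and reg: "regular X" and \<tau>: "stopping \<tau>"
  shows "integrable M (\<lambda>\<omega>. X (\<tau> \<omega>) \<omega>)"
    and "(\<integral>\<omega>. X (\<tau> \<omega>) \<omega> \<partial>M) = (\<integral>\<omega>. X T \<omega> \<partial>M)"
proof -
  have XT: "integrable M (X T)" using mart T_pos by (auto simp: martingale_def)
  let ?X = "\<lambda>n \<omega>. X (grid T n (\<tau> \<omega>)) \<omega>" and ?Y = "\<lambda>\<omega>. X (\<tau> \<omega>) \<omega>"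
  let ?q = "\<lambda>K x::real. max (\<bar>x\<bar> - K) 0" and ?clip = "\<lambda>K x::real. max (- K) (min K x)"
  have [measurable]: "?X n \<in> borel_measurable M" "?Y \<in> borel_measurable M" for n
    using regular_measurable[OF reg \<tau>] regular_measurable[OF reg stopping_grid[OF \<tau>]] by auto
  have lim: "(\<lambda>n. ?X n \<omega>) \<longlonglongrightarrow> ?Y \<omega>" if \<omega>: "\<omega> \<in> space M" for \<omega>
    using reg stoppingD[OF \<tau>] \<omega> stoppingD(2,3)[OF stopping_grid[OF \<tau>]]
    by (intro path_tendsto[OF _ \<omega> grid_tendsto[OF T_pos]]) (auto simp: regular_def)
  have iq: "integrable M (\<lambda>\<omega>. ?q K (X T \<omega>))" if "0 \<le> K" for K
    by (rule Bochner_Integration.integrable_bound[OF XT]) (use XT that in auto)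
  have q: "integrable M (\<lambda>\<omega>. ?q K (?X n \<omega>))" "(\<integral>\<omega>. ?q K (?X n \<omega>) \<partial>M) \<le> (\<integral>\<omega>. ?q K (X T \<omega>) \<partial>M)" if "0 \<le> K" for K n
    using grid_sampling_convex[OF mart \<tau> convex_excess _ iq[OF that]] by auto
  have Xn: "integrable M (?X n)" "(\<integral>\<omega>. ?X n \<omega> \<partial>M) = (\<integral>\<omega>. X T \<omega> \<partial>M)" for n
  proof -
    \<comment> \<open>The convex inequality for the identity and for its negative yields equality of
      means.\<close>
    have "convex_on UNIV (\<lambda>x::real. x)" "convex_on UNIV (\<lambda>x::real. - x)"
      by (auto intro!: convex_onI)
    then show "integrable M (?X n)" "(\<integral>\<omega>. ?X n \<omega> \<partial>M) = (\<integral>\<omega>. X T \<omega> \<partial>M)"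
      using grid_sampling_convex[OF mart \<tau>, of "\<lambda>x. x" n]
        grid_sampling_convex[OF mart \<tau>, of "\<lambda>x. - x" n] XT by auto
  qed
  \<comment> \<open>Fatou's lemma carries the excess bound from the grid times to \<tau>; the case
    \<open>K = 0\<close> is the integrability of the value at \<tau>.\<close>
  have fatou: "integrable M (\<lambda>\<omega>. ?q K (?Y \<omega>))" "(\<integral>\<omega>. ?q K (?Y \<omega>) \<partial>M) \<le> (\<integral>\<omega>. ?q K (X T \<omega>) \<partial>M)" if K: "0 \<le> K" for K
  proof -
    have "(\<integral>\<^sup>+\<omega>. ennreal (?q K (?Y \<omega>)) \<partial>M) = (\<integral>\<^sup>+\<omega>. liminf (\<lambda>n. ennreal (?q K (?X n \<omega>))) \<partial>M)"
    proof (rule nn_integral_cong)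
      fix \<omega> assume "\<omega> \<in> space M"
      then have "(\<lambda>n. ennreal (?q K (?X n \<omega>))) \<longlonglongrightarrow> ennreal (?q K (?Y \<omega>))"
        by (intro tendsto_ennrealI tendsto_max tendsto_diff tendsto_rabs lim tendsto_const)
      then show "ennreal (?q K (?Y \<omega>)) = liminf (\<lambda>n. ennreal (?q K (?X n \<omega>)))"
        by (intro lim_imp_Liminf[symmetric]) simp_all
    qed
    also have "\<dots> \<le> liminf (\<lambda>n. \<integral>\<^sup>+\<omega>. ennreal (?q K (?X n \<omega>)) \<partial>M)"
      by (rule nn_integral_liminf) auto
    also have "\<dots> \<le> liminf (\<lambda>n::nat. ennreal (\<integral>\<omega>. ?q K (X T \<omega>) \<partial>M))"
      using q[OF K] by (intro Liminf_mono always_eventually allI)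
        (subst nn_integral_eq_integral, auto simp del: max.bounded_iff intro!: ennreal_leI)
    finally have le: "(\<integral>\<^sup>+\<omega>. ennreal (?q K (?Y \<omega>)) \<partial>M) \<le> ennreal (\<integral>\<omega>. ?q K (X T \<omega>) \<partial>M)"
      by (simp add: Liminf_const)
    show i: "integrable M (\<lambda>\<omega>. ?q K (?Y \<omega>))"
    proof (rule integrableI_nonneg)
      show "(\<integral>\<^sup>+\<omega>. ennreal (?q K (?Y \<omega>)) \<partial>M) < \<infinity>"
        using le_less_trans[OF le ennreal_less_top] by (simp only: infinity_ennreal_def)
    qed auto
    show "(\<integral>\<omega>. ?q K (?Y \<omega>) \<partial>M) \<le> (\<integral>\<omega>. ?q K (X T \<omega>) \<partial>M)"
      using le i by (subst (asm) nn_integral_eq_integral) (auto intro: Bochner_Integration.integral_nonneg)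
  qed
  from fatou(1)[of 0] have "integrable M (\<lambda>\<omega>. \<bar>?Y \<omega>\<bar>)" by (simp add: max_absorb1)
  then show Y: "integrable M ?Y" by (rule integrable_abs_cancel) simp
  have clip: "\<bar>(\<integral>\<omega>. f \<omega> \<partial>M) - (\<integral>\<omega>. ?clip K (f \<omega>) \<partial>M)\<bar> \<le> (\<integral>\<omega>. ?q K (f \<omega>) \<partial>M)"
    if "integrable M f" "integrable M (\<lambda>\<omega>. ?q K (f \<omega>))" "0 \<le> K" for f :: "'a \<Rightarrow> real" and K
  proof -
    have i: "integrable M (\<lambda>\<omega>. ?clip K (f \<omega>))"
      by (rule Bochner_Integration.integrable_bound[OF that(1)]) (use that in auto)
    have "\<bar>\<integral>\<omega>. f \<omega> - ?clip K (f \<omega>) \<partial>M\<bar> \<le> (\<integral>\<omega>. \<bar>f \<omega> - ?clip K (f \<omega>)\<bar> \<partial>M)"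
      by (rule integral_abs_bound)
    also have "\<dots> = (\<integral>\<omega>. ?q K (f \<omega>) \<partial>M)"
      using that(3) by (intro Bochner_Integration.integral_cong) auto
    finally show ?thesis using that(1) i by simp
  qed
  \<comment> \<open>Clipped values converge boundedly. Clipping costs at most the mean excess, once
    along the grid and once at \<tau>, whence the factor 2. Letting \<open>K\<close> grow then
    removes the error.\<close>
  have bound: "\<bar>(\<integral>\<omega>. ?Y \<omega> \<partial>M) - (\<integral>\<omega>. X T \<omega> \<partial>M)\<bar> \<le> 2 * (\<integral>\<omega>. ?q K (X T \<omega>) \<partial>M)" if K: "0 \<le> K" for K
  proof -
    have "(\<lambda>n. \<integral>\<omega>. ?clip K (?X n \<omega>) \<partial>M) \<longlonglongrightarrow> (\<integral>\<omega>. ?clip K (?Y \<omega>) \<partial>M)"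
    proof (rule integral_dominated_convergence[where w="\<lambda>_. K"])
      show "AE \<omega> in M. (\<lambda>n. ?clip K (?X n \<omega>)) \<longlonglongrightarrow> ?clip K (?Y \<omega>)"
        by (intro AE_I2 tendsto_max tendsto_min tendsto_const lim)
      show "AE \<omega> in M. norm (?clip K (?X n \<omega>)) \<le> K" for n
        by (intro AE_I2) (use K in auto)
    qed simp_all
    then have "(\<lambda>n. \<bar>(\<integral>\<omega>. X T \<omega> \<partial>M) - (\<integral>\<omega>. ?clip K (?X n \<omega>) \<partial>M)\<bar>)
        \<longlonglongrightarrow> \<bar>(\<integral>\<omega>. X T \<omega> \<partial>M) - (\<integral>\<omega>. ?clip K (?Y \<omega>) \<partial>M)\<bar>"
      by (intro tendsto_intros)
    then have "\<bar>(\<integral>\<omega>. X T \<omega> \<partial>M) - (\<integral>\<omega>. ?clip K (?Y \<omega>) \<partial>M)\<bar> \<le> (\<integral>\<omega>. ?q K (X T \<omega>) \<partial>M)"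
      by (rule LIMSEQ_le_const2)
        (intro exI allI impI order_trans[OF clip[OF Xn(1) q(1)[OF K] K, unfolded Xn(2)] q(2)[OF K]])
    moreover have "\<bar>(\<integral>\<omega>. ?Y \<omega> \<partial>M) - (\<integral>\<omega>. ?clip K (?Y \<omega>) \<partial>M)\<bar> \<le> (\<integral>\<omega>. ?q K (X T \<omega>) \<partial>M)"
      using order_trans[OF clip[OF Y fatou(1)[OF K] K] fatou(2)[OF K]] .
    ultimately show ?thesis by linarith
  qed
  have "(\<lambda>k. \<integral>\<omega>. ?q (real k) (X T \<omega>) \<partial>M) \<longlonglongrightarrow> (\<integral>\<omega>. 0 \<partial>M)"
  proof (rule integral_dominated_convergence[where w="\<lambda>\<omega>. \<bar>X T \<omega>\<bar>"])
    show "AE \<omega> in M. (\<lambda>k. ?q (real k) (X T \<omega>)) \<longlonglongrightarrow> 0"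
    proof (rule AE_I2, rule tendsto_eventually)
      fix \<omega>
      show "\<forall>\<^sub>F k in sequentially. ?q (real k) (X T \<omega>) = 0"
        using eventually_ge_at_top[of "nat \<lceil>\<bar>X T \<omega>\<bar>\<rceil>"] by eventually_elim (intro max_absorb2, linarith)
    qed
  qed (use XT in auto)
  then have "(\<lambda>k. 2 * (\<integral>\<omega>. ?q (real k) (X T \<omega>) \<partial>M)) \<longlonglongrightarrow> 0"
    using tendsto_mult_left[of _ 0 sequentially 2] by simp
  then have "\<bar>(\<integral>\<omega>. ?Y \<omega> \<partial>M) - (\<integral>\<omega>. X T \<omega> \<partial>M)\<bar> \<le> 0"
    by (rule LIMSEQ_le_const) (intro exI allI impI bound of_nat_0_le_iff)
  then show "(\<integral>\<omega>. ?Y \<omega> \<partial>M) = (\<integral>\<omega>. X T \<omega> \<partial>M)" by simp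
qed

text \<open>The stopping time equal to \<sigma> on \<open>A\<close> and to \<tau> elsewhere has the
  same mean value of \<open>X\<close> as \<tau>; the contributions outside \<open>A\<close>
  cancel.\<close>

lemma integral_if_stopping:
  assumes reg: "regular X"
    and mean: "\<And>\<tau>. stopping \<tau> \<Longrightarrow> integrable M (\<lambda>\<omega>. X (\<tau> \<omega>) \<omega>) \<and> (\<integral>\<omega>. X (\<tau> \<omega>) \<omega> \<partial>M) = c"
    and \<sigma>: "stopping \<sigma>" and \<tau>: "stopping \<tau>" and le: "\<And>\<omega>. \<omega> \<in> space M \<Longrightarrow> \<sigma> \<omega> \<le> \<tau> \<omega>"
    and A: "A \<in> sets (pre_sigma \<sigma>)"
  shows "set_lebesgue_integral M A (\<lambda>\<omega>. X (\<tau> \<omega>) \<omega>) = set_lebesgue_integral M A (\<lambda>\<omega>. X (\<sigma> \<omega>) \<omega>)"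
proof -
  have AM: "A \<in> sets M" using subalgebra_pre_sigma[OF \<sigma>] A by (auto simp: subalgebra_def)
  let ?S = "\<lambda>\<omega>. indicator A \<omega> *\<^sub>R X (\<sigma> \<omega>) \<omega>" and ?T = "\<lambda>\<omega>. indicator A \<omega> *\<^sub>R X (\<tau> \<omega>) \<omega>"
  have int: "integrable M ?S" "integrable M ?T" "integrable M (\<lambda>\<omega>. X (\<tau> \<omega>) \<omega>)"
    by (intro integrable_mult_indicator[OF AM] conjunct1[OF mean] \<sigma> \<tau>)+
  have "(\<integral>\<omega>. X (if \<omega> \<in> A then \<sigma> \<omega> else \<tau> \<omega>) \<omega> \<partial>M) = (\<integral>\<omega>. ?S \<omega> - ?T \<omega> + X (\<tau> \<omega>) \<omega> \<partial>M)"
    by (rule Bochner_Integration.integral_cong[OF refl]) (simp split: split_indicator)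
  also have "\<dots> = (\<integral>\<omega>. ?S \<omega> \<partial>M) - (\<integral>\<omega>. ?T \<omega> \<partial>M) + (\<integral>\<omega>. X (\<tau> \<omega>) \<omega> \<partial>M)"
    by (simp only: Bochner_Integration.integral_add Bochner_Integration.integral_diff
        Bochner_Integration.integrable_diff int)
  finally have "(\<integral>\<omega>. X (if \<omega> \<in> A then \<sigma> \<omega> else \<tau> \<omega>) \<omega> \<partial>M) = \<dots>" .
  moreover have "stopping (\<lambda>\<omega>. if \<omega> \<in> A then \<sigma> \<omega> else \<tau> \<omega>)"
    by (rule stopping_if[OF \<sigma> \<tau> _ A]) (rule le)
  note conjunct2[OF mean[OF this]] conjunct2[OF mean[OF \<tau>]]
  ultimately show ?thesis unfolding set_lebesgue_integral_def by linarith
qed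

text \<open>Lets the martingale property of slices and of localised processes be checked through
  plain expectations. It follows by comparing constant times on events of
  \<open>F s\<close>.\<close>

lemma martingaleI_mean:
  assumes reg: "regular X"
    and mean: "\<And>\<tau>. stopping \<tau> \<Longrightarrow> integrable M (\<lambda>\<omega>. X (\<tau> \<omega>) \<omega>) \<and> (\<integral>\<omega>. X (\<tau> \<omega>) \<omega> \<partial>M) = c"
  shows "martingale M F T X"
  unfolding martingale_def
proof (intro conjI ballI allI impI)
  show "adapted F T X" using reg by (simp add: regular_def)
  show int: "integrable M (X t)" if "t \<in> {0..T}" for t
    using mean[OF stopping_const[of t]] that by auto
  fix s t assume st: "0 \<le> s \<and> s \<le> t \<and> t \<le> T"
  interpret sigma_finite_subalgebra M "F s"
    by (rule sigma_finite_subalgebraI[OF subalgebra_F]) (use st in auto)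
  show "AE \<omega> in M. real_cond_exp M (F s) (X t) \<omega> = X s \<omega>"
  proof (rule real_cond_exp_charact)
    show "integrable M (X t)" "integrable M (X s)" using int st by auto
    show "X s \<in> borel_measurable (F s)" using reg st by (auto simp: regular_def adapted_def)
    fix A assume A: "A \<in> sets (F s)"
    \<comment> \<open>Before \<open>s\<close> the tested event is empty; from \<open>s\<close> on it
      is \<open>A\<close> itself.\<close>
    have "A \<in> sets (pre_sigma (\<lambda>_. s))"
    proof (rule sets_pre_sigmaI[OF stopping_time_const])
      show "{\<omega> \<in> A. s \<le> t} \<in> sets (F t)" for t
        using A sets_F_mono[of s t] by (cases "s \<le> t") auto
    qed
    show "set_lebesgue_integral M A (X t) = set_lebesgue_integral M A (X s)"
      by (rule integral_if_stopping[OF reg mean stopping_const stopping_const _ \<open>A \<in> sets (pre_sigma (\<lambda>_. s))\<close>])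
        (use st in simp_all)
  qed
qed

text \<open>Equality of integrals over all events of \<open>pre_sigma \<sigma>\<close> characterises
  the conditional expectation. It is used to freeze the earlier factor in
  \<open>bmo_product_mean\<close>.\<close>

lemma optional_sampling:
  assumes mart: "martingale M F T X" and reg: "regular X"
    and \<sigma>: "stopping \<sigma>" and \<tau>: "stopping \<tau>" and le: "\<And>\<omega>. \<omega> \<in> space M \<Longrightarrow> \<sigma> \<omega> \<le> \<tau> \<omega>"
  shows "AE \<omega> in M. real_cond_exp M (pre_sigma \<sigma>) (\<lambda>\<omega>. X (\<tau> \<omega>) \<omega>) \<omega> = X (\<sigma> \<omega>) \<omega>"
proof -
  interpret sigma_finite_subalgebra M "pre_sigma \<sigma>"
    by (rule sigma_finite_subalgebraI[OF subalgebra_pre_sigma[OF \<sigma>]])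
  note mean = optional_stopping[OF mart reg]
  show ?thesis
  proof (rule real_cond_exp_charact)
    show "set_lebesgue_integral M A (\<lambda>\<omega>. X (\<tau> \<omega>) \<omega>) = set_lebesgue_integral M A (\<lambda>\<omega>. X (\<sigma> \<omega>) \<omega>)"
      if "A \<in> sets (pre_sigma \<sigma>)" for A
      by (rule integral_if_stopping[OF reg conjI[OF mean] \<sigma> \<tau> le that])
  qed (rule mean(1)[OF \<tau>] mean(1)[OF \<sigma>] regular_pre_sigma_measurable[OF reg \<sigma>])+
qed

section \<open>Slices of BMO-martingales\<close>

lemma regular_stopped:
  assumes X: "regular X" and \<tau>: "stopping \<tau>"
  shows "regular (\<lambda>t \<omega>. X (min (\<tau> \<omega>) t) \<omega>)"
  unfolding regular_def adapted_def continuous_paths_def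
proof (intro conjI ballI)
  show "(\<lambda>\<omega>. X (min (\<tau> \<omega>) t) \<omega>) \<in> borel_measurable (F t)" if "t \<in> {0..T}" for t
    using regular_stopped_measurable[OF X \<tau>] that by auto
  fix \<omega> assume \<omega>: "\<omega> \<in> space M"
  have X\<omega>: "continuous_on {0..T} (\<lambda>t. X t \<omega>)" using X \<omega> by (auto simp: regular_def continuous_paths_def)
  show "continuous_on {0..T} (\<lambda>t. X (min (\<tau> \<omega>) t) \<omega>)"
    by (rule continuous_on_compose2[OF X\<omega>]) (use stoppingD[OF \<tau>] \<omega> in \<open>auto intro!: continuous_intros\<close>)
qed

lemma regular_diff: "regular X \<Longrightarrow> regular Y \<Longrightarrow> regular (\<lambda>t \<omega>. X t \<omega> - Y t \<omega>)"
  by (auto simp: regular_def adapted_def continuous_paths_def intro: continuous_intros borel_measurable_diff)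

lemma regular_power2: "regular X \<Longrightarrow> regular (\<lambda>t \<omega>. (X t \<omega>)\<^sup>2)"
  by (auto simp: regular_def adapted_def continuous_paths_def intro: continuous_intros borel_measurable_power)

lemma regular_initial: "regular X \<Longrightarrow> regular (\<lambda>t. X 0)"
  using T_pos by (auto simp: regular_def adapted_def continuous_paths_def
      intro: measurable_from_subalg[OF subalgebra_F_mono])

lemma regular_stopped_increment:
  "regular X \<Longrightarrow> stopping \<sigma> \<Longrightarrow> stopping \<tau> \<Longrightarrow> regular (stopped_increment X \<sigma> \<tau>)"
  using regular_diff[OF regular_stopped regular_stopped] by (simp add: stopped_increment_def[abs_def])

text \<open>Continuity is known only inside the interval from 0 to \<open>T\<close>, so each
  one-sided filter is first restricted to a subinterval.\<close>

lemma regular_cadlag: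
  assumes "regular X"
  shows "cadlag_paths M T X"
  unfolding cadlag_paths_def
proof (intro ballI conjI)
  fix \<omega> t assume \<omega>: "\<omega> \<in> space M"
  have c: "((\<lambda>s. X s \<omega>) \<longlongrightarrow> X t \<omega>) (at t within {0..T})" if "t \<in> {0..T}" for t
    using assms \<omega> that by (auto simp: regular_def continuous_paths_def continuous_on_def)
  show "continuous (at_right t) (\<lambda>s. X s \<omega>)" if "t \<in> {0..<T}"
  proof -
    have "at_right t = at t within {t<..T}"
      using that by (intro at_within_nhd[where S="{..<T}"]) auto
    moreover have "((\<lambda>s. X s \<omega>) \<longlongrightarrow> X t \<omega>) (at t within {t<..T})"
      by (rule tendsto_within_subset[OF c]) (use that in auto)
    ultimately show ?thesis by (simp add: continuous_within)
  qed
  show "\<exists>l. ((\<lambda>s. X s \<omega>) \<longlongrightarrow> l) (at_left t)" if "t \<in> {0<..T}"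
  proof -
    have "at_left t = at t within {0..<t}"
      using that by (intro at_within_nhd[where S="{0<..}"]) auto
    moreover have "((\<lambda>s. X s \<omega>) \<longlongrightarrow> X t \<omega>) (at t within {0..<t})"
      by (rule tendsto_within_subset[OF c]) (use that in auto)
    ultimately show ?thesis by auto
  qed
qed

lemma bmo_martingaleD:
  assumes "bmo_martingale M F T X"
  shows "martingale M F T X" "regular X" "\<omega> \<in> space M \<Longrightarrow> X 0 \<omega> = 0"
  using assms by (auto simp: bmo_martingale_def regular_def martingale_def)

text \<open>Integrating the conditional bound leaves at most c^2, as the total mass is 1.\<close>

lemma bmo_second_moment:
  assumes X: "regular X" and c: "bmo_bound M F T X c" and \<tau>: "stopping \<tau>"
  shows "integrable M (\<lambda>\<omega>. (X T \<omega> - X (\<tau> \<omega>) \<omega>)\<^sup>2)"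
proof -
  interpret sigma_finite_subalgebra M "pre_sigma \<tau>"
    by (rule sigma_finite_subalgebraI[OF subalgebra_pre_sigma[OF \<tau>]])
  have [measurable]: "(\<lambda>\<omega>. X (\<tau> \<omega>) \<omega>) \<in> borel_measurable M" "X T \<in> borel_measurable M"
    using regular_measurable[OF X \<tau>] regular_measurable[OF X stopping_const[of T]] T_pos by auto
  let ?f = "\<lambda>\<omega>. ennreal (\<bar>X T \<omega> - X (\<tau> \<omega>) \<omega>\<bar> ^ 2)"
  have "(\<integral>\<^sup>+\<omega>. ?f \<omega> \<partial>M) = (\<integral>\<^sup>+\<omega>. nn_cond_exp M (pre_sigma \<tau>) ?f \<omega> \<partial>M)"
    using nn_cond_exp_intg[of "\<lambda>_. 1" ?f] by simp
  also have "\<dots> \<le> (\<integral>\<^sup>+\<omega>. ennreal (c\<^sup>2) \<partial>M)"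
    using c \<tau> by (intro nn_integral_mono_AE) (simp add: bmo_bound_def)
  also have "\<dots> < \<infinity>" by (simp add: emeasure_space_1)
  finally show ?thesis by (intro integrableI_nonneg) auto
qed

text \<open>As \<open>X\<close> starts at 0, its value at \<tau> is the difference of the increments
  to \<open>T\<close> from 0 and from \<tau>; the BMO condition controls both.\<close>

lemma bmo_square_integrable:
  assumes X: "bmo_martingale M F T X" and \<tau>: "stopping \<tau>"
  shows "integrable M (\<lambda>\<omega>. (X (\<tau> \<omega>) \<omega>)\<^sup>2)"
proof -
  note reg = bmo_martingaleD(2)[OF X]
  obtain c where c: "bmo_bound M F T X c" using X by (auto simp: bmo_martingale_def)
  have [measurable]: "(\<lambda>\<omega>. X (\<tau> \<omega>) \<omega>) \<in> borel_measurable M"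
    by (rule regular_measurable[OF reg \<tau>])
  have "integrable M (\<lambda>\<omega>. 2 * (X T \<omega> - X 0 \<omega>)\<^sup>2 + 2 * (X T \<omega> - X (\<tau> \<omega>) \<omega>)\<^sup>2)"
    using bmo_second_moment[OF reg c \<tau>] bmo_second_moment[OF reg c stopping_const[of 0]] T_pos by auto
  then show ?thesis
  proof (rule Bochner_Integration.integrable_bound)
    show "AE \<omega> in M. norm ((X (\<tau> \<omega>) \<omega>)\<^sup>2) \<le> norm (2 * (X T \<omega> - X 0 \<omega>)\<^sup>2 + 2 * (X T \<omega> - X (\<tau> \<omega>) \<omega>)\<^sup>2)"
    proof (rule AE_I2)
      fix \<omega> assume "\<omega> \<in> space M"
      then have "X 0 \<omega> = 0" by (rule bmo_martingaleD(3)[OF X])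
      \<comment> \<open>The difference of the two sides is the square of 2y - x.\<close>
      moreover have "x\<^sup>2 \<le> 2 * y\<^sup>2 + 2 * (y - x)\<^sup>2" for x y :: real
        using zero_le_power2[of "2 * y - x"] by (simp add: power2_eq_square algebra_simps)
      ultimately show "norm ((X (\<tau> \<omega>) \<omega>)\<^sup>2) \<le> norm (2 * (X T \<omega> - X 0 \<omega>)\<^sup>2 + 2 * (X T \<omega> - X (\<tau> \<omega>) \<omega>)\<^sup>2)"
        by simp
    qed
  qed simp
qed

text \<open>Orthogonality of increments: conditioning at \<sigma> replaces the later value by the
  earlier one, and square integrability makes the product integrable.\<close>

lemma bmo_product_mean:
  assumes X: "bmo_martingale M F T X" and \<sigma>: "stopping \<sigma>" and \<tau>: "stopping \<tau>"
    and le: "\<And>\<omega>. \<omega> \<in> space M \<Longrightarrow> \<sigma> \<omega> \<le> \<tau> \<omega>"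
  shows "integrable M (\<lambda>\<omega>. X (\<sigma> \<omega>) \<omega> * X (\<tau> \<omega>) \<omega>)"
    and "(\<integral>\<omega>. X (\<sigma> \<omega>) \<omega> * X (\<tau> \<omega>) \<omega> \<partial>M) = (\<integral>\<omega>. (X (\<sigma> \<omega>) \<omega>)\<^sup>2 \<partial>M)"
proof -
  note reg = bmo_martingaleD(2)[OF X]
  interpret sigma_finite_subalgebra M "pre_sigma \<sigma>"
    by (rule sigma_finite_subalgebraI[OF subalgebra_pre_sigma[OF \<sigma>]])
  have m [measurable]: "(\<lambda>\<omega>. X (\<sigma> \<omega>) \<omega>) \<in> borel_measurable M" "(\<lambda>\<omega>. X (\<tau> \<omega>) \<omega>) \<in> borel_measurable M"
    using regular_measurable[OF reg] \<sigma> \<tau> by auto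
  have "integrable M (\<lambda>\<omega>. (X (\<sigma> \<omega>) \<omega>)\<^sup>2 + (X (\<tau> \<omega>) \<omega>)\<^sup>2)"
    using bmo_square_integrable[OF X] \<sigma> \<tau> by auto
  then show i: "integrable M (\<lambda>\<omega>. X (\<sigma> \<omega>) \<omega> * X (\<tau> \<omega>) \<omega>)"
  proof (rule Bochner_Integration.integrable_bound)
    have "\<bar>x * y\<bar> \<le> x\<^sup>2 + y\<^sup>2" for x y :: real
    proof -
      have "2 * (\<bar>x\<bar> * \<bar>y\<bar>) \<le> \<bar>x\<bar>\<^sup>2 + \<bar>y\<bar>\<^sup>2" using sum_squares_bound[of "\<bar>x\<bar>" "\<bar>y\<bar>"] by simp
      moreover have "0 \<le> \<bar>x\<bar> * \<bar>y\<bar>" by simp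
      ultimately have "\<bar>x\<bar> * \<bar>y\<bar> \<le> \<bar>x\<bar>\<^sup>2 + \<bar>y\<bar>\<^sup>2" by linarith
      then show ?thesis by (simp add: abs_mult)
    qed
    then show "AE \<omega> in M. norm (X (\<sigma> \<omega>) \<omega> * X (\<tau> \<omega>) \<omega>) \<le> norm ((X (\<sigma> \<omega>) \<omega>)\<^sup>2 + (X (\<tau> \<omega>) \<omega>)\<^sup>2)"
      by simp
  qed simp
  have "(\<integral>\<omega>. X (\<sigma> \<omega>) \<omega> * X (\<tau> \<omega>) \<omega> \<partial>M) = (\<integral>\<omega>. X (\<sigma> \<omega>) \<omega> * real_cond_exp M (pre_sigma \<sigma>) (\<lambda>\<omega>. X (\<tau> \<omega>) \<omega>) \<omega> \<partial>M)"
    by (rule real_cond_exp_intg(2)[symmetric, OF i regular_pre_sigma_measurable[OF reg \<sigma>] m(2)])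
  also have "\<dots> = (\<integral>\<omega>. (X (\<sigma> \<omega>) \<omega>)\<^sup>2 \<partial>M)"
  proof (rule integral_cong_AE)
    show "AE \<omega> in M. X (\<sigma> \<omega>) \<omega> * real_cond_exp M (pre_sigma \<sigma>) (\<lambda>\<omega>. X (\<tau> \<omega>) \<omega>) \<omega> = (X (\<sigma> \<omega>) \<omega>)\<^sup>2"
    proof -
      have "AE \<omega> in M. real_cond_exp M (pre_sigma \<sigma>) (\<lambda>\<omega>. X (\<tau> \<omega>) \<omega>) \<omega> = X (\<sigma> \<omega>) \<omega>"
        by (rule optional_sampling[OF bmo_martingaleD(1)[OF X] reg \<sigma> \<tau>]) (rule le)
      then show ?thesis by eventually_elim (simp add: power2_eq_square)
    qed
  qed measurable
  finally show "(\<integral>\<omega>. X (\<sigma> \<omega>) \<omega> * X (\<tau> \<omega>) \<omega> \<partial>M) = (\<integral>\<omega>. (X (\<sigma> \<omega>) \<omega>)\<^sup>2 \<partial>M)" .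
qed

text \<open>Tower property, conditioning at \<theta> first. It is needed because the increment of a
  slice after \<rho> is made of increments of \<open>X\<close> that start later than \<rho>.\<close>

lemma bmo_bound_earlier:
  assumes X: "regular X" and c: "bmo_bound M F T X c" and \<rho>: "stopping \<rho>" and \<theta>: "stopping \<theta>"
    and le: "\<And>\<omega>. \<omega> \<in> space M \<Longrightarrow> \<rho> \<omega> \<le> \<theta> \<omega>"
  shows "AE \<omega> in M. nn_cond_exp M (pre_sigma \<rho>) (\<lambda>\<omega>. ennreal (\<bar>X T \<omega> - X (\<theta> \<omega>) \<omega>\<bar> ^ 2)) \<omega> \<le> ennreal (c\<^sup>2)"
proof -
  interpret sigma_finite_subalgebra M "pre_sigma \<rho>"
    by (rule sigma_finite_subalgebraI[OF subalgebra_pre_sigma[OF \<rho>]])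
  have [measurable]: "(\<lambda>\<omega>. X (\<theta> \<omega>) \<omega>) \<in> borel_measurable M" "X T \<in> borel_measurable M"
    using regular_measurable[OF X \<theta>] regular_measurable[OF X stopping_const[of T]] T_pos by auto
  let ?f = "\<lambda>\<omega>. ennreal (\<bar>X T \<omega> - X (\<theta> \<omega>) \<omega>\<bar> ^ 2)"
  have "AE \<omega> in M. nn_cond_exp M (pre_sigma \<rho>) ?f \<omega> = nn_cond_exp M (pre_sigma \<rho>) (nn_cond_exp M (pre_sigma \<theta>) ?f) \<omega>"
    by (rule nn_cond_exp_nested_subalg[OF subalgebra_pre_sigma[OF \<theta>] subalgebra_pre_sigma_le[OF \<rho> \<theta> le]]) auto
  moreover have "AE \<omega> in M. nn_cond_exp M (pre_sigma \<rho>) (nn_cond_exp M (pre_sigma \<theta>) ?f) \<omega>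
      \<le> nn_cond_exp M (pre_sigma \<rho>) (\<lambda>_. ennreal (c\<^sup>2)) \<omega>"
    using c \<theta> by (intro nn_cond_exp_mono) (auto simp: bmo_bound_def)
  moreover have "AE \<omega> in M. ennreal (c\<^sup>2) = nn_cond_exp M (pre_sigma \<rho>) (\<lambda>_. ennreal (c\<^sup>2)) \<omega>"
    by (rule nn_cond_exp_F_meas) simp
  ultimately show ?thesis by eventually_elim simp
qed

text \<open>Optional stopping gives both stopped processes the same mean, so the slice has mean zero
  at every stopping time. The constant 2c only certifies a finite norm: squaring a difference of two
  increments gives 2(c^2 + c^2).\<close>

lemma bmo_martingale_stopped_increment:
  assumes X: "bmo_martingale M F T X" and \<sigma>: "stopping \<sigma>" and \<tau>: "stopping \<tau>"
    and le: "\<And>\<omega>. \<omega> \<in> space M \<Longrightarrow> \<sigma> \<omega> \<le> \<tau> \<omega>"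
  shows "bmo_martingale M F T (stopped_increment X \<sigma> \<tau>)"
proof -
  let ?Y = "stopped_increment X \<sigma> \<tau>"
  note reg = bmo_martingaleD(2)[OF X]
  note regY = regular_stopped_increment[OF reg \<sigma> \<tau>]
  obtain c where c: "0 < c" "bmo_bound M F T X c" using X by (auto simp: bmo_martingale_def)
  have "martingale M F T ?Y"
  proof (rule martingaleI_mean[OF regY])
    fix \<theta> assume \<theta>: "stopping \<theta>"
    show "integrable M (\<lambda>\<omega>. ?Y (\<theta> \<omega>) \<omega>) \<and> (\<integral>\<omega>. ?Y (\<theta> \<omega>) \<omega> \<partial>M) = 0"
      using optional_stopping[OF bmo_martingaleD(1)[OF X] reg stopping_min[OF \<sigma> \<theta>]]
        optional_stopping[OF bmo_martingaleD(1)[OF X] reg stopping_min[OF \<tau> \<theta>]]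
      by (simp add: stopped_increment_def)
  qed
  moreover have "bmo_bound M F T ?Y (2 * c)"
    unfolding bmo_bound_def
  proof (intro allI impI)
    fix \<rho> assume \<rho>: "stopping \<rho>"
    interpret sigma_finite_subalgebra M "pre_sigma \<rho>"
      by (rule sigma_finite_subalgebraI[OF subalgebra_pre_sigma[OF \<rho>]])
    let ?E = "nn_cond_exp M (pre_sigma \<rho>)"
    let ?\<theta> = "\<lambda>\<alpha> \<omega>. max (\<alpha> \<omega>) (\<rho> \<omega>)"
    let ?f = "\<lambda>\<alpha> \<omega>. ennreal (\<bar>X T \<omega> - X (?\<theta> \<alpha> \<omega>) \<omega>\<bar> ^ 2)"
    have [measurable]: "X T \<in> borel_measurable M" "?Y T \<in> borel_measurable M"
      "(\<lambda>\<omega>. X (?\<theta> \<sigma> \<omega>) \<omega>) \<in> borel_measurable M" "(\<lambda>\<omega>. X (?\<theta> \<tau> \<omega>) \<omega>) \<in> borel_measurable M"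
      "(\<lambda>\<omega>. ?Y (\<rho> \<omega>) \<omega>) \<in> borel_measurable M"
      using regular_measurable[OF reg stopping_const[of T]] regular_measurable[OF regY stopping_const[of T]] T_pos
        regular_measurable[OF reg stopping_max[OF \<sigma> \<rho>]] regular_measurable[OF reg stopping_max[OF \<tau> \<rho>]]
        regular_measurable[OF regY \<rho>] by auto
    have f [measurable]: "?f \<sigma> \<in> borel_measurable M" "?f \<tau> \<in> borel_measurable M"
      "(\<lambda>\<omega>. ennreal (\<bar>?Y T \<omega> - ?Y (\<rho> \<omega>) \<omega>\<bar> ^ 2)) \<in> borel_measurable M" by measurable
    have "AE \<omega> in M. ?E (\<lambda>\<omega>. ennreal (\<bar>?Y T \<omega> - ?Y (\<rho> \<omega>) \<omega>\<bar> ^ 2)) \<omega> \<le> ?E (\<lambda>\<omega>. 2 * (?f \<sigma> \<omega> + ?f \<tau> \<omega>)) \<omega>"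
    proof (rule nn_cond_exp_mono)
      show "AE \<omega> in M. ennreal (\<bar>?Y T \<omega> - ?Y (\<rho> \<omega>) \<omega>\<bar> ^ 2) \<le> 2 * (?f \<sigma> \<omega> + ?f \<tau> \<omega>)"
      proof (rule AE_I2)
        fix \<omega> assume \<omega>: "\<omega> \<in> space M"
        define a b where "a = X T \<omega> - X (?\<theta> \<sigma> \<omega>) \<omega>" and "b = X T \<omega> - X (?\<theta> \<tau> \<omega>) \<omega>"
        \<comment> \<open>The remaining increment of the slice runs from
          \<open>max \<sigma> \<rho>\<close> to \<open>max \<tau> \<rho>\<close>; passing through
          \<open>X T\<close> makes it a difference of two terms that the BMO condition of
          \<open>X\<close> bounds.\<close>
        have "?Y T \<omega> - ?Y (\<rho> \<omega>) \<omega> = a - b"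
          using stoppingD(2,3)[OF \<sigma> \<omega>] stoppingD(2,3)[OF \<tau> \<omega>] stoppingD(2,3)[OF \<rho> \<omega>] le[OF \<omega>]
          by (cases "\<rho> \<omega> \<le> \<sigma> \<omega>"; cases "\<rho> \<omega> \<le> \<tau> \<omega>")
            (simp_all add: stopped_increment_def a_def b_def min_absorb1 min_absorb2 max_absorb1 max_absorb2)
        moreover have "(a - b)\<^sup>2 \<le> 2 * (a\<^sup>2 + b\<^sup>2)"
          using zero_le_power2[of "a + b"] by (simp add: power2_eq_square algebra_simps)
        ultimately have "\<bar>?Y T \<omega> - ?Y (\<rho> \<omega>) \<omega>\<bar> ^ 2 \<le> 2 * (\<bar>a\<bar>^2 + \<bar>b\<bar>^2)" by simp
        then have "ennreal (\<bar>?Y T \<omega> - ?Y (\<rho> \<omega>) \<omega>\<bar> ^ 2) \<le> ennreal (2 * (\<bar>a\<bar>^2 + \<bar>b\<bar>^2))" by (rule ennreal_leI)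
        also have "\<dots> = 2 * (ennreal (\<bar>a\<bar>^2) + ennreal (\<bar>b\<bar>^2))" by (simp add: ennreal_mult)
        finally show "ennreal (\<bar>?Y T \<omega> - ?Y (\<rho> \<omega>) \<omega>\<bar> ^ 2) \<le> 2 * (?f \<sigma> \<omega> + ?f \<tau> \<omega>)"
          by (simp only: a_def b_def)
      qed
    qed simp_all
    moreover have "AE \<omega> in M. 2 * ?E (\<lambda>\<omega>. ?f \<sigma> \<omega> + ?f \<tau> \<omega>) \<omega> = ?E (\<lambda>\<omega>. 2 * (?f \<sigma> \<omega> + ?f \<tau> \<omega>)) \<omega>"
      by (rule nn_cond_exp_prod) simp_all
    moreover have "AE \<omega> in M. ?E (?f \<sigma>) \<omega> + ?E (?f \<tau>) \<omega> = ?E (\<lambda>\<omega>. ?f \<sigma> \<omega> + ?f \<tau> \<omega>) \<omega>"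
      by (rule nn_cond_exp_sum) simp_all
    moreover have "AE \<omega> in M. ?E (?f \<alpha>) \<omega> \<le> ennreal (c\<^sup>2)" if "stopping \<alpha>" for \<alpha>
      by (rule bmo_bound_earlier[OF reg c(2) \<rho> stopping_max[OF that \<rho>]]) simp
    note this[OF \<sigma>] this[OF \<tau>]
    ultimately show "AE \<omega> in M. ?E (\<lambda>\<omega>. ennreal (\<bar>?Y T \<omega> - ?Y (\<rho> \<omega>) \<omega>\<bar> ^ 2)) \<omega> \<le> ennreal ((2 * c)\<^sup>2)"
    proof eventually_elim
      case (elim \<omega>)
      have "?E (\<lambda>\<omega>. ennreal (\<bar>?Y T \<omega> - ?Y (\<rho> \<omega>) \<omega>\<bar> ^ 2)) \<omega> \<le> 2 * (?E (?f \<sigma>) \<omega> + ?E (?f \<tau>) \<omega>)"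
        unfolding elim(2,3) by (rule elim(1))
      also have "\<dots> \<le> 2 * (ennreal (c\<^sup>2) + ennreal (c\<^sup>2))"
        by (intro mult_left_mono add_mono elim(4,5) zero_le)
      also have "\<dots> = ennreal (2 * (c\<^sup>2 + c\<^sup>2))"
        by (simp only: ennreal_mult[OF zero_le_numeral add_nonneg_nonneg[OF zero_le_power2 zero_le_power2]]
            ennreal_plus[OF zero_le_power2 zero_le_power2] ennreal_numeral)
      also have "2 * (c\<^sup>2 + c\<^sup>2) = (2 * c)\<^sup>2" by (simp add: power_mult_distrib)
      finally show ?case .
    qed
  qed
  moreover have "?Y 0 \<omega> = 0" if "\<omega> \<in> space M" for \<omega>
    using stoppingD(2)[OF \<sigma> that] stoppingD(2)[OF \<tau> that] by (simp add: stopped_increment_def min_absorb2)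
  ultimately show ?thesis
    using regY c(1) by (auto simp: bmo_martingale_def regular_def intro!: exI[of _ "2 * c"])
qed

text \<open>The cross term \<open>X\<^sup>\<sigma> (X\<^sup>\<tau> - X\<^sup>\<sigma>)\<close> that appears when expanding the square of the
  increment has mean zero at every stopping time, because \<open>X\<close> is square integrable.\<close>

lemma is_bracket_stopped_increment:
  assumes X: "bmo_martingale M F T X" and Q: "is_bracket M F T X Q"
    and \<sigma>: "stopping \<sigma>" and \<tau>: "stopping \<tau>" and le: "\<And>\<omega>. \<omega> \<in> space M \<Longrightarrow> \<sigma> \<omega> \<le> \<tau> \<omega>"
  shows "is_bracket M F T (stopped_increment X \<sigma> \<tau>) (stopped_increment Q \<sigma> \<tau>)"
proof -
  let ?Y = "stopped_increment X \<sigma> \<tau>" and ?R = "stopped_increment Q \<sigma> \<tau>"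
  let ?N = "\<lambda>t \<omega>. (X t \<omega>)\<^sup>2 - Q t \<omega>" and ?Z = "\<lambda>t \<omega>. (?Y t \<omega>)\<^sup>2 - ?R t \<omega>"
  note regX = bmo_martingaleD(2)[OF X]
  have regQ: "regular Q" using Q by (simp add: is_bracket_def regular_def)
  have Q0: "Q 0 \<omega> = 0" and Qm: "mono_on {0..T} (\<lambda>t. Q t \<omega>)" if "\<omega> \<in> space M" for \<omega>
    using Q that by (auto simp: is_bracket_def)
  note regR = regular_stopped_increment[OF regQ \<sigma> \<tau>]
  have regN: "regular ?N" by (intro regular_diff regular_power2 regX regQ)
  have regZ: "regular ?Z" by (intro regular_diff regular_power2 regular_stopped_increment regX regQ \<sigma> \<tau>)
  have start: "?Y 0 \<omega> = 0" "?R 0 \<omega> = 0" if "\<omega> \<in> space M" for \<omega>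
    using stoppingD(2)[OF \<sigma> that] stoppingD(2)[OF \<tau> that] by (simp_all add: stopped_increment_def min_absorb2)
  have mono: "mono_on {0..T} (\<lambda>t. ?R t \<omega>)" if \<omega>: "\<omega> \<in> space M" for \<omega>
  proof (rule mono_onI)
    fix s t assume st: "s \<in> {0..T}" "t \<in> {0..T}" "s \<le> t"
    have b: "0 \<le> \<sigma> \<omega>" "\<sigma> \<omega> \<le> \<tau> \<omega>" "\<tau> \<omega> \<le> T"
      using stoppingD(2)[OF \<sigma> \<omega>] stoppingD(3)[OF \<tau> \<omega>] le[OF \<omega>] by auto
    \<comment> \<open>The first inequality serves times after \<sigma>, where the subtracted term is
      frozen; the second gives a nonnegative value at \<open>t\<close>, which suffices when
      \<open>s\<close> precedes \<sigma> and the slice is still 0.\<close>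
    have "Q (min (\<tau> \<omega>) s) \<omega> \<le> Q (min (\<tau> \<omega>) t) \<omega>" "Q (min (\<sigma> \<omega>) t) \<omega> \<le> Q (min (\<tau> \<omega>) t) \<omega>"
      using b st by (auto intro!: mono_onD[OF Qm[OF \<omega>]])
    then show "?R s \<omega> \<le> ?R t \<omega>"
      using b st by (cases "\<sigma> \<omega> \<le> s") (auto simp: stopped_increment_def min_absorb1 min_absorb2)
  qed
  \<comment> \<open>The sequence localising the process of \<open>X\<close> and \<open>Q\<close>
    localises that of the slice as well.\<close>
  obtain \<rho> where \<rho>': "\<forall>n. stopping (\<rho> n)"
    and inc: "\<forall>n. \<forall>\<omega>\<in>space M. \<rho> n \<omega> \<le> \<rho> (Suc n) \<omega>"
    and ev: "AE \<omega> in M. eventually (\<lambda>n. \<rho> n \<omega> = T) sequentially"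
    and N': "\<forall>n. martingale M F T (\<lambda>t \<omega>. ?N (min (\<rho> n \<omega>) t) \<omega> - ?N 0 \<omega>)"
    using Q unfolding is_bracket_def local_martingale_def by (elim conjE exE) (rule that)
  note \<rho> = \<rho>'[rule_format] and N = N'[rule_format]
  have "martingale M F T (\<lambda>t \<omega>. ?Z (min (\<rho> n \<omega>) t) \<omega> - ?Z 0 \<omega>)" for n
  proof (rule martingaleI_mean)
    show "regular (\<lambda>t \<omega>. ?Z (min (\<rho> n \<omega>) t) \<omega> - ?Z 0 \<omega>)"
      by (rule regular_diff[OF regular_stopped[OF regZ \<rho>] regular_initial[OF regZ]])
    have regNn: "regular (\<lambda>t \<omega>. ?N (min (\<rho> n \<omega>) t) \<omega> - ?N 0 \<omega>)"
      by (rule regular_diff[OF regular_stopped[OF regN \<rho>] regular_initial[OF regN]])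
    fix \<theta> assume \<theta>: "stopping \<theta>"
    let ?\<theta> = "\<lambda>\<alpha> \<omega>. min (\<alpha> \<omega>) (min (\<rho> n \<omega>) (\<theta> \<omega>))"
    have s: "stopping (?\<theta> \<alpha>)" if "stopping \<alpha>" for \<alpha>
      by (intro stopping_min that \<rho> \<theta>)
    \<comment> \<open>The mean does not depend on \<alpha>, so the contributions of \<sigma> and
      \<tau> to \<open>?g\<close> cancel.\<close>
    have N_mean: "integrable M (\<lambda>\<omega>. ?N (?\<theta> \<alpha> \<omega>) \<omega>)" "(\<integral>\<omega>. ?N (?\<theta> \<alpha> \<omega>) \<omega> \<partial>M) = (\<integral>\<omega>. ?N (\<rho> n \<omega>) \<omega> \<partial>M)"
      if "stopping \<alpha>" for \<alpha>
    proof -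
      have 1: "?N (min (\<rho> n \<omega>) (?\<theta> \<alpha> \<omega>)) \<omega> - ?N 0 \<omega> = ?N (?\<theta> \<alpha> \<omega>) \<omega>"
        and 2: "?N (min (\<rho> n \<omega>) T) \<omega> - ?N 0 \<omega> = ?N (\<rho> n \<omega>) \<omega>" if "\<omega> \<in> space M" for \<omega>
        using bmo_martingaleD(3)[OF X that] Q0[OF that] stoppingD(3)[OF \<rho> that]
        by (simp_all add: min.left_commute min_absorb1)
      from optional_stopping[OF N[of n] regNn s[OF that]] 1 2
      show "integrable M (\<lambda>\<omega>. ?N (?\<theta> \<alpha> \<omega>) \<omega>)" "(\<integral>\<omega>. ?N (?\<theta> \<alpha> \<omega>) \<omega> \<partial>M) = (\<integral>\<omega>. ?N (\<rho> n \<omega>) \<omega> \<partial>M)"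
        by (simp_all cong: Bochner_Integration.integrable_cong Bochner_Integration.integral_cong)
    qed
    let ?a = "\<lambda>\<omega>. X (?\<theta> \<sigma> \<omega>) \<omega>" and ?b = "\<lambda>\<omega>. X (?\<theta> \<tau> \<omega>) \<omega>"
    \<comment> \<open>From (b - a)^2 = b^2 - a^2 - 2(ab - a^2), with the bracket terms distributed
      over the two squares.\<close>
    let ?g = "\<lambda>\<omega>. ?N (?\<theta> \<tau> \<omega>) \<omega> - ?N (?\<theta> \<sigma> \<omega>) \<omega> - 2 * (?a \<omega> * ?b \<omega> - (?a \<omega>)\<^sup>2)"
    have le': "?\<theta> \<sigma> \<omega> \<le> ?\<theta> \<tau> \<omega>" if "\<omega> \<in> space M" for \<omega> using le[OF that] by auto
    have ab: "integrable M (\<lambda>\<omega>. ?a \<omega> * ?b \<omega>)" "(\<integral>\<omega>. ?a \<omega> * ?b \<omega> \<partial>M) = (\<integral>\<omega>. (?a \<omega>)\<^sup>2 \<partial>M)"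
      by (rule bmo_product_mean(1)[OF X s[OF \<sigma>] s[OF \<tau>]], rule le', simp)
        (rule bmo_product_mean(2)[OF X s[OF \<sigma>] s[OF \<tau>]], rule le', simp)
    note aa = bmo_square_integrable[OF X s[OF \<sigma>]]
    have "integrable M (\<lambda>\<omega>. A \<omega> - B \<omega> - 2 * (C \<omega> - D \<omega>)) \<and>
        (\<integral>\<omega>. A \<omega> - B \<omega> - 2 * (C \<omega> - D \<omega>) \<partial>M) = (\<integral>\<omega>. A \<omega> \<partial>M) - (\<integral>\<omega>. B \<omega> \<partial>M) - 2 * ((\<integral>\<omega>. C \<omega> \<partial>M) - (\<integral>\<omega>. D \<omega> \<partial>M))"
      if "integrable M A" "integrable M B" "integrable M C" "integrable M D" for A B C D :: "'a \<Rightarrow> real"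
      using that by simp
    note g' = this[OF N_mean(1)[OF \<tau>] N_mean(1)[OF \<sigma>] ab(1) aa]
    have g: "integrable M ?g" using g' by (rule conjunct1)
    have g0: "(\<integral>\<omega>. ?g \<omega> \<partial>M) = 0"
      by (rule trans[OF conjunct2[OF g']])
        (simp only: N_mean(2)[OF \<tau>] N_mean(2)[OF \<sigma>] ab(2) diff_self mult_zero_right)
    have eq: "?Z (min (\<rho> n \<omega>) (\<theta> \<omega>)) \<omega> - ?Z 0 \<omega> = ?g \<omega>" if "\<omega> \<in> space M" for \<omega>
      using start[OF that] by (simp add: stopped_increment_def power2_eq_square algebra_simps)
    show "integrable M (\<lambda>\<omega>. ?Z (min (\<rho> n \<omega>) (\<theta> \<omega>)) \<omega> - ?Z 0 \<omega>) \<and>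
        (\<integral>\<omega>. ?Z (min (\<rho> n \<omega>) (\<theta> \<omega>)) \<omega> - ?Z 0 \<omega> \<partial>M) = 0"
    proof
      show "integrable M (\<lambda>\<omega>. ?Z (min (\<rho> n \<omega>) (\<theta> \<omega>)) \<omega> - ?Z 0 \<omega>)"
        using g by (subst Bochner_Integration.integrable_cong[OF refl eq])
      show "(\<integral>\<omega>. ?Z (min (\<rho> n \<omega>) (\<theta> \<omega>)) \<omega> - ?Z 0 \<omega> \<partial>M) = 0"
        using g0 by (subst Bochner_Integration.integral_cong[OF refl eq])
    qed
  qed
  then have "local_martingale M F T ?Z"
    unfolding local_martingale_def using regZ[unfolded regular_def] regular_cadlag[OF regZ] \<rho>' inc ev
    by (intro conjI exI[of _ \<rho>]) (simp_all only: simp_thms)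
  then show ?thesis
    unfolding is_bracket_def using regR[unfolded regular_def] start(2) mono by (intro conjI ballI) (simp_all only:)
qed

section \<open>Reverse Hoelder inequalities\<close>

text \<open>The condition inside \<open>reverse_Hoelder\<close>, raised to the power \<beta>. In
  this form factors known at the conditioning time pull out and successive bounds multiply.\<close>

definition reverse_Hoelder_bound :: "real \<Rightarrow> (real \<Rightarrow> 'a \<Rightarrow> real) \<Rightarrow> real \<Rightarrow> bool" where
  "reverse_Hoelder_bound \<beta> Z c \<longleftrightarrow> (\<forall>\<tau>. stopping \<tau> \<longrightarrow>
     (AE \<omega> in M. nn_cond_exp M (pre_sigma \<tau>) (\<lambda>\<omega>. ennreal (\<bar>Z T \<omega>\<bar> powr \<beta>)) \<omega> \<le> ennreal ((c * Z (\<tau> \<omega>) \<omega>) powr \<beta>)))"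

lemma reverse_Hoelder_eq:
  assumes "0 < \<beta>" "\<And>t \<omega>. 0 \<le> Z t \<omega>"
  shows "reverse_Hoelder M F T \<beta> Z = Inf (ennreal ` {c. 0 \<le> c \<and> reverse_Hoelder_bound \<beta> Z c})"
proof -
  have "{c. 0 \<le> c \<and> reverse_Hoelder_bound \<beta> Z c} = {c. 0 \<le> c \<and> (\<forall>\<tau>. stopping \<tau> \<longrightarrow>
      (AE \<omega> in M. ennreal_powr (nn_cond_exp M (pre_sigma \<tau>) (\<lambda>\<omega>. ennreal (\<bar>Z T \<omega>\<bar> powr \<beta>)) \<omega>) (1 / \<beta>)
        \<le> ennreal (c * Z (\<tau> \<omega>) \<omega>)))}"
    unfolding reverse_Hoelder_bound_def
    by (intro Collect_cong conj_cong refl) (simp add: ennreal_powr_inverse_le_iff assms)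
  then show ?thesis unfolding reverse_Hoelder_def by (simp only:)
qed

lemma reverse_Hoelder_leI:
  assumes "0 < \<beta>" "\<And>t \<omega>. 0 \<le> Z t \<omega>" "0 \<le> c" "reverse_Hoelder_bound \<beta> Z c"
  shows "reverse_Hoelder M F T \<beta> Z \<le> ennreal c"
  unfolding reverse_Hoelder_eq[OF assms(1,2)] using assms(3,4) by (intro Inf_lower imageI CollectI conjI)

text \<open>The condition is monotone in the constant because \<open>Z\<close> is nonnegative, so
  anything strictly above the infimum is admissible.\<close>

lemma reverse_Hoelder_lessD:
  assumes "0 < \<beta>" "\<And>t \<omega>. 0 \<le> Z t \<omega>" "0 \<le> c" "reverse_Hoelder M F T \<beta> Z < ennreal c"
  shows "reverse_Hoelder_bound \<beta> Z c"
proof -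
  obtain d where d: "0 \<le> d" "reverse_Hoelder_bound \<beta> Z d" "ennreal d < ennreal c"
    using assms(4) unfolding reverse_Hoelder_eq[OF assms(1,2)] Inf_less_iff by blast
  then have "d \<le> c" by (simp add: ennreal_less_iff)
  show ?thesis unfolding reverse_Hoelder_bound_def
  proof (intro allI impI)
    fix \<tau> assume "stopping \<tau>"
    with d(2) have "AE \<omega> in M. nn_cond_exp M (pre_sigma \<tau>) (\<lambda>\<omega>. ennreal (\<bar>Z T \<omega>\<bar> powr \<beta>)) \<omega> \<le> ennreal ((d * Z (\<tau> \<omega>) \<omega>) powr \<beta>)"
      by (simp add: reverse_Hoelder_bound_def)
    then show "AE \<omega> in M. nn_cond_exp M (pre_sigma \<tau>) (\<lambda>\<omega>. ennreal (\<bar>Z T \<omega>\<bar> powr \<beta>)) \<omega> \<le> ennreal ((c * Z (\<tau> \<omega>) \<omega>) powr \<beta>)"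
    proof eventually_elim
      case (elim \<omega>)
      have "(d * Z (\<tau> \<omega>) \<omega>) powr \<beta> \<le> (c * Z (\<tau> \<omega>) \<omega>) powr \<beta>"
        using d(1) \<open>d \<le> c\<close> assms(1,2) by (intro powr_mono2 mult_right_mono mult_nonneg_nonneg) auto
      with elim show ?case by (meson ennreal_leI order_trans)
    qed
  qed
qed

lemma regular_stoch_exp: "regular X \<Longrightarrow> regular Q \<Longrightarrow> regular (stoch_exp X Q)"
  unfolding regular_def adapted_def continuous_paths_def stoch_exp_def[abs_def]
  by (auto intro!: continuous_intros borel_measurable_exp measurable_compose[OF _ borel_measurable_exp]
      borel_measurable_diff borel_measurable_times)

lemma stoch_exp_pos: "0 < stoch_exp X Q t \<omega>"
  by (simp add: stoch_exp_def)

lemmas stoch_exp_nonneg = stoch_exp_pos[THEN less_imp_le]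

text \<open>Exponents are additive, so the claim reduces to increments of \<open>X\<close> and of
  \<open>Q\<close>. The quotient on the right is known at \<open>max \<rho> \<sigma>\<close>, while
  the last factor is the terminal value to which the bound for the slice applies.\<close>

lemma stoch_exp_slice:
  assumes "stopping \<sigma>" "stopping \<tau>" "stopping \<rho>" "\<sigma> \<omega> \<le> \<tau> \<omega>" and \<omega>: "\<omega> \<in> space M"
  shows "stoch_exp X Q (max (\<rho> \<omega>) (\<tau> \<omega>)) \<omega> =
    stoch_exp X Q (max (\<rho> \<omega>) (\<sigma> \<omega>)) \<omega> /
      stoch_exp (stopped_increment X \<sigma> \<tau>) (stopped_increment Q \<sigma> \<tau>) (max (\<rho> \<omega>) (\<sigma> \<omega>)) \<omega> *
      stoch_exp (stopped_increment X \<sigma> \<tau>) (stopped_increment Q \<sigma> \<tau>) T \<omega>"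
proof -
  have "Y (max (\<rho> \<omega>) (\<tau> \<omega>)) \<omega> - Y (max (\<rho> \<omega>) (\<sigma> \<omega>)) \<omega> =
      stopped_increment Y \<sigma> \<tau> T \<omega> - stopped_increment Y \<sigma> \<tau> (max (\<rho> \<omega>) (\<sigma> \<omega>)) \<omega>" for Y :: "real \<Rightarrow> 'a \<Rightarrow> real"
    using stoppingD(2,3)[OF assms(1) \<omega>] stoppingD(2,3)[OF assms(2) \<omega>] stoppingD(2,3)[OF assms(3) \<omega>] assms(4)
    by (cases "\<rho> \<omega> \<le> \<sigma> \<omega>"; cases "\<rho> \<omega> \<le> \<tau> \<omega>")
      (simp_all add: stopped_increment_def min_absorb1 min_absorb2 max_absorb1 max_absorb2)
  from this[of X] this[of Q] show ?thesis
    by (simp add: stoch_exp_def exp_diff[symmetric] exp_add[symmetric])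
qed

text \<open>The quotient from \<open>stoch_exp_slice\<close> leaves the conditional expectation; its
  denominator then cancels against the value of the slice exponential in the reverse Hoelder bound,
  leaving one factor \<open>c powr \<beta>\<close>.\<close>

lemma reverse_Hoelder_slice:
  assumes X: "regular X" and Q: "regular Q" and \<sigma>: "stopping \<sigma>" and \<tau>: "stopping \<tau>" and \<rho>: "stopping \<rho>"
    and le: "\<And>\<omega>. \<omega> \<in> space M \<Longrightarrow> \<sigma> \<omega> \<le> \<tau> \<omega>" and c: "0 \<le> c"
    and bound: "reverse_Hoelder_bound \<beta> (stoch_exp (stopped_increment X \<sigma> \<tau>) (stopped_increment Q \<sigma> \<tau>)) c"
  shows "AE \<omega> in M. nn_cond_exp M (pre_sigma (\<lambda>\<omega>. max (\<rho> \<omega>) (\<sigma> \<omega>)))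
      (\<lambda>\<omega>. ennreal (stoch_exp X Q (max (\<rho> \<omega>) (\<tau> \<omega>)) \<omega> powr \<beta>)) \<omega>
    \<le> ennreal (c powr \<beta> * stoch_exp X Q (max (\<rho> \<omega>) (\<sigma> \<omega>)) \<omega> powr \<beta>)"
proof -
  let ?Z = "stoch_exp X Q" and ?S = "stoch_exp (stopped_increment X \<sigma> \<tau>) (stopped_increment Q \<sigma> \<tau>)"
  let ?s = "\<lambda>\<omega>. max (\<rho> \<omega>) (\<sigma> \<omega>)" and ?t = "\<lambda>\<omega>. max (\<rho> \<omega>) (\<tau> \<omega>)"
  have s: "stopping ?s" and t: "stopping ?t" by (intro stopping_max \<rho> \<sigma> \<tau>)+
  have regZ: "regular ?Z" by (rule regular_stoch_exp[OF X Q])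
  have regS: "regular ?S"
    by (intro regular_stoch_exp regular_stopped_increment X Q \<sigma> \<tau>)
  interpret sigma_finite_subalgebra M "pre_sigma ?s"
    by (rule sigma_finite_subalgebraI[OF subalgebra_pre_sigma[OF s]])
  let ?E = "nn_cond_exp M (pre_sigma ?s)"
  let ?f = "\<lambda>\<omega>. ennreal ((?Z (?s \<omega>) \<omega> / ?S (?s \<omega>) \<omega>) powr \<beta>)" and ?g = "\<lambda>\<omega>. ennreal (\<bar>?S T \<omega>\<bar> powr \<beta>)"
  have ZS: "(\<lambda>\<omega>. ?Z (?s \<omega>) \<omega>) \<in> borel_measurable (pre_sigma ?s)" "(\<lambda>\<omega>. ?S (?s \<omega>) \<omega>) \<in> borel_measurable (pre_sigma ?s)"
    by (rule regular_pre_sigma_measurable[OF regZ s], rule regular_pre_sigma_measurable[OF regS s])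
  have f: "?f \<in> borel_measurable (pre_sigma ?s)" using ZS by measurable
  have [measurable]: "(\<lambda>\<omega>. ?Z (?t \<omega>) \<omega>) \<in> borel_measurable M" "?S T \<in> borel_measurable M"
    using regular_measurable[OF regZ t] regular_measurable[OF regS stopping_const[of T]] T_pos by auto
  have g: "?g \<in> borel_measurable M" by measurable
  have "AE \<omega> in M. ?E (\<lambda>\<omega>. ennreal (?Z (?t \<omega>) \<omega> powr \<beta>)) \<omega> = ?E (\<lambda>\<omega>. ?f \<omega> * ?g \<omega>) \<omega>"
  proof (rule nn_cond_exp_cong)
    show "AE \<omega> in M. ennreal (?Z (?t \<omega>) \<omega> powr \<beta>) = ?f \<omega> * ?g \<omega>"
    proof (rule AE_I2)
      fix \<omega> assume \<omega>: "\<omega> \<in> space M"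
      have "?Z (?t \<omega>) \<omega> powr \<beta> = (?Z (?s \<omega>) \<omega> / ?S (?s \<omega>) \<omega>) powr \<beta> * \<bar>?S T \<omega>\<bar> powr \<beta>"
        unfolding stoch_exp_slice[OF \<sigma> \<tau> \<rho> le[OF \<omega>] \<omega>, of X Q]
        by (simp add: powr_mult powr_divide stoch_exp_nonneg)
      then show "ennreal (?Z (?t \<omega>) \<omega> powr \<beta>) = ?f \<omega> * ?g \<omega>"
        by (simp only: ennreal_mult[OF powr_ge_zero powr_ge_zero])
    qed
    show "(\<lambda>\<omega>. ?f \<omega> * ?g \<omega>) \<in> borel_measurable M"
      by (intro borel_measurable_times_ennreal measurable_from_subalg[OF subalgebra_pre_sigma[OF s] f] g)
  qed measurable
  moreover have "AE \<omega> in M. ?f \<omega> * ?E ?g \<omega> = ?E (\<lambda>\<omega>. ?f \<omega> * ?g \<omega>) \<omega>"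
    by (rule nn_cond_exp_prod[OF f g])
  moreover have "AE \<omega> in M. ?E ?g \<omega> \<le> ennreal ((c * ?S (?s \<omega>) \<omega>) powr \<beta>)"
    using bound s unfolding reverse_Hoelder_bound_def by blast
  ultimately show ?thesis
  proof eventually_elim
    case (elim \<omega>)
    have "?f \<omega> * ?E ?g \<omega> \<le> ?f \<omega> * ennreal ((c * ?S (?s \<omega>) \<omega>) powr \<beta>)"
      by (intro mult_left_mono elim(3) zero_le)
    also have "\<dots> = ennreal ((?Z (?s \<omega>) \<omega> / ?S (?s \<omega>) \<omega>) powr \<beta> * (c * ?S (?s \<omega>) \<omega>) powr \<beta>)"
      by (rule ennreal_mult[OF powr_ge_zero powr_ge_zero, symmetric])
    also have "(?Z (?s \<omega>) \<omega> / ?S (?s \<omega>) \<omega>) powr \<beta> * (c * ?S (?s \<omega>) \<omega>) powr \<beta> = c powr \<beta> * ?Z (?s \<omega>) \<omega> powr \<beta>"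
      using c stoch_exp_pos[of "stopped_increment X \<sigma> \<tau>" "stopped_increment Q \<sigma> \<tau>" "?s \<omega>" \<omega>] stoch_exp_pos[of X Q "?s \<omega>" \<omega>]
      by (simp add: powr_mult powr_divide)
    finally show ?case unfolding elim(1) elim(2)[symmetric] .
  qed
qed

lemma reverse_Hoelder_bound_product:
  assumes X: "regular X" and Q: "regular Q" and \<beta>: "0 < \<beta>" and c: "0 \<le> c"
    and \<tau>: "\<And>k. k \<le> N \<Longrightarrow> stopping (\<tau> k)"
    and ends: "\<And>\<omega>. \<omega> \<in> space M \<Longrightarrow> \<tau> 0 \<omega> = 0" "\<And>\<omega>. \<omega> \<in> space M \<Longrightarrow> \<tau> N \<omega> = T"
    and le: "\<And>k \<omega>. k < N \<Longrightarrow> \<omega> \<in> space M \<Longrightarrow> \<tau> k \<omega> \<le> \<tau> (Suc k) \<omega>"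
    and bound: "\<And>k. k < N \<Longrightarrow> reverse_Hoelder_bound \<beta>
      (stoch_exp (stopped_increment X (\<tau> k) (\<tau> (Suc k))) (stopped_increment Q (\<tau> k) (\<tau> (Suc k)))) c"
  shows "reverse_Hoelder_bound \<beta> (stoch_exp X Q) (c ^ N)"
  unfolding reverse_Hoelder_bound_def
proof (intro allI impI)
  fix \<rho> assume \<rho>: "stopping \<rho>"
  let ?Z = "stoch_exp X Q" and ?s = "\<lambda>k \<omega>. max (\<rho> \<omega>) (\<tau> k \<omega>)"
  let ?g = "\<lambda>\<omega>. ennreal (\<bar>?Z T \<omega>\<bar> powr \<beta>)"
  have regZ: "regular ?Z" by (rule regular_stoch_exp[OF X Q])
  have s: "stopping (?s k)" if "k \<le> N" for k by (rule stopping_max[OF \<rho> \<tau>[OF that]])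
  have sN: "?s N \<omega> = T" if "\<omega> \<in> space M" for \<omega>
    using stoppingD(3)[OF \<rho> that] ends(2)[OF that] by simp
  have [measurable]: "?Z T \<in> borel_measurable M"
    using regular_measurable[OF regZ stopping_const[of T]] T_pos by auto
  have Zs: "(\<lambda>\<omega>. ?Z (?s k \<omega>) \<omega>) \<in> borel_measurable M" if "k \<le> N" for k
    by (rule regular_measurable[OF regZ s[OF that]])
  \<comment> \<open>Backward induction: \<open>j\<close> counts the slices already absorbed from the
    end. For \<open>j = 0\<close> the terminal value is known at the conditioning time; each step
    inserts one more conditioning by the tower property.\<close>
  have main: "AE \<omega> in M. nn_cond_exp M (pre_sigma (?s (N - j))) ?g \<omega> \<le> ennreal ((c ^ j * ?Z (?s (N - j) \<omega>) \<omega>) powr \<beta>)"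
    if "j \<le> N" for j
    using that
  proof (induction j)
    case 0
    interpret sigma_finite_subalgebra M "pre_sigma (?s N)"
      by (rule sigma_finite_subalgebraI[OF subalgebra_pre_sigma[OF s[OF order_refl]]])
    have "(\<lambda>\<omega>. ?Z (?s N \<omega>) \<omega>) \<in> borel_measurable (pre_sigma (?s N))"
      by (rule regular_pre_sigma_measurable[OF regZ s[OF order_refl]])
    then have "(\<lambda>\<omega>. ennreal (\<bar>?Z (?s N \<omega>) \<omega>\<bar> powr \<beta>)) \<in> borel_measurable (pre_sigma (?s N))"
      by measurable
    also have "?this \<longleftrightarrow> ?g \<in> borel_measurable (pre_sigma (?s N))"
      by (rule measurable_cong) (simp only: space_pre_sigma sN)
    finally have "AE \<omega> in M. ?g \<omega> = nn_cond_exp M (pre_sigma (?s N)) ?g \<omega>"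
      by (rule nn_cond_exp_F_meas)
    with AE_space show ?case
    proof eventually_elim
      case (elim \<omega>)
      have "nn_cond_exp M (pre_sigma (?s N)) ?g \<omega> = ?g \<omega>" using elim(2) by (rule sym)
      also have "\<dots> = ennreal ((c ^ 0 * ?Z (?s N \<omega>) \<omega>) powr \<beta>)"
        unfolding sN[OF elim(1)] by (simp add: stoch_exp_nonneg)
      finally show ?case by simp
    qed
  next
    case (Suc j)
    define k where "k = N - Suc j"
    have k: "k < N" "Suc k = N - j" "Suc k \<le> N" "k \<le> N" using Suc.prems by (auto simp: k_def)
    interpret sigma_finite_subalgebra M "pre_sigma (?s k)"
      by (rule sigma_finite_subalgebraI[OF subalgebra_pre_sigma[OF s[OF k(4)]]])
    let ?E = "nn_cond_exp M (pre_sigma (?s k))" and ?E' = "nn_cond_exp M (pre_sigma (?s (Suc k)))"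
    let ?h = "\<lambda>\<omega>. ennreal (?Z (?s (Suc k) \<omega>) \<omega> powr \<beta>)" and ?d = "(c ^ j) powr \<beta>"
    have h: "?h \<in> borel_measurable M" using Zs[OF k(3)] by measurable
    have "AE \<omega> in M. ?E ?g \<omega> = ?E (?E' ?g) \<omega>"
    proof (rule nn_cond_exp_nested_subalg)
      show "subalgebra M (pre_sigma (?s (Suc k)))" by (rule subalgebra_pre_sigma[OF s[OF k(3)]])
      show "subalgebra (pre_sigma (?s (Suc k))) (pre_sigma (?s k))"
        using le[OF k(1)] by (intro subalgebra_pre_sigma_le s k(3,4) max.mono order_refl)
    qed measurable
    moreover have "AE \<omega> in M. ?E (?E' ?g) \<omega> \<le> ?E (\<lambda>\<omega>. ennreal ?d * ?h \<omega>) \<omega>"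
    proof (rule nn_cond_exp_mono)
      have "AE \<omega> in M. ?E' ?g \<omega> \<le> ennreal ((c ^ j * ?Z (?s (Suc k) \<omega>) \<omega>) powr \<beta>)"
        using Suc.IH Suc.prems unfolding k(2) by simp
      then show "AE \<omega> in M. ?E' ?g \<omega> \<le> ennreal ?d * ?h \<omega>"
        by eventually_elim (simp add: c powr_mult ennreal_mult stoch_exp_nonneg)
      show "(\<lambda>\<omega>. ennreal ?d * ?h \<omega>) \<in> borel_measurable M" by (intro borel_measurable_times_ennreal h) simp
    qed measurable
    moreover have "AE \<omega> in M. ennreal ?d * ?E ?h \<omega> = ?E (\<lambda>\<omega>. ennreal ?d * ?h \<omega>) \<omega>"
      by (rule nn_cond_exp_prod[OF _ h]) simp
    moreover have "AE \<omega> in M. ?E ?h \<omega> \<le> ennreal (c powr \<beta> * ?Z (?s k \<omega>) \<omega> powr \<beta>)"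
      by (rule reverse_Hoelder_slice[OF X Q \<tau>[OF k(4)] \<tau>[OF k(3)] \<rho> le[OF k(1)] c bound[OF k(1)]])
    ultimately have "AE \<omega> in M. ?E ?g \<omega> \<le> ennreal ((c ^ Suc j * ?Z (?s k \<omega>) \<omega>) powr \<beta>)"
    proof eventually_elim
      case (elim \<omega>)
      have "?E ?g \<omega> \<le> ennreal ?d * ?E ?h \<omega>"
        unfolding elim(1) elim(3) by (rule elim(2))
      also have "\<dots> \<le> ennreal ?d * ennreal (c powr \<beta> * ?Z (?s k \<omega>) \<omega> powr \<beta>)"
        by (intro mult_left_mono elim(4) zero_le)
      also have "\<dots> = ennreal (?d * (c powr \<beta> * ?Z (?s k \<omega>) \<omega> powr \<beta>))"
        by (rule ennreal_mult[symmetric]) (auto intro: mult_nonneg_nonneg)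
      also have "?d * (c powr \<beta> * ?Z (?s k \<omega>) \<omega> powr \<beta>) = (c ^ Suc j * ?Z (?s k \<omega>) \<omega>) powr \<beta>"
        using c stoch_exp_pos[of X Q "?s k \<omega>" \<omega>] by (simp add: powr_mult)
      finally show ?case .
    qed
    then show ?case unfolding k_def .
  qed
  have s0: "?s 0 \<omega> = \<rho> \<omega>" if "\<omega> \<in> space M" for \<omega>
    using stoppingD(2)[OF \<rho> that] ends(1)[OF that] by simp
  \<comment> \<open>The two times agree only on the sample space, not as functions, so their
    sigma-algebras are identified by two inclusions.\<close>
  have "sets (pre_sigma (?s 0)) = sets (pre_sigma \<rho>)"
    using s0 stoppingD(1)[OF s[OF le0]] stoppingD(1)[OF \<rho>]
    by (intro antisym mono_pre_sigma) (simp_all only: order_refl)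
  then have "pre_sigma (?s 0) = pre_sigma \<rho>"
    by (rule measure_eqI) (simp only: measure_pre_sigma)
  with main[OF order_refl]
  have "AE \<omega> in M. nn_cond_exp M (pre_sigma \<rho>) ?g \<omega> \<le> ennreal ((c ^ N * ?Z (?s 0 \<omega>) \<omega>) powr \<beta>)"
    by (simp only: diff_self_eq_0)
  with AE_space show "AE \<omega> in M. nn_cond_exp M (pre_sigma \<rho>) ?g \<omega> \<le> ennreal ((c ^ N * ?Z (\<rho> \<omega>) \<omega>) powr \<beta>)"
    by eventually_elim (simp only: s0)
qed

section \<open>Slicings and the infimum over them\<close>

lemma bmo_norm_nonneg:
  assumes "bmo_martingale M F T X"
  shows "0 \<le> bmo_norm M F T X"
  unfolding bmo_norm_def using assms by (intro cInf_greatest) (auto simp: bmo_martingale_def)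

text \<open>Membership in the set whose infimum is \<open>sliceable_number\<close>.\<close>

definition slicing :: "nat \<Rightarrow> (real \<Rightarrow> 'a \<Rightarrow> real) \<Rightarrow> real \<Rightarrow> bool" where
  "slicing N X \<epsilon> \<longleftrightarrow> 0 < \<epsilon> \<and>
     (\<exists>\<tau> :: nat \<Rightarrow> 'a \<Rightarrow> real.
          (\<forall>k\<le>N. stopping (\<tau> k)) \<and>
          (\<forall>\<omega>\<in>space M. \<tau> 0 \<omega> = 0 \<and> \<tau> N \<omega> = T \<and> (\<forall>k<N. \<tau> k \<omega> \<le> \<tau> (Suc k) \<omega>)) \<and>
          (SUP k\<in>{1..N}. bmo_norm M F T (stopped_increment X (\<tau> (k - 1)) (\<tau> k))) \<le> \<epsilon>)"

text \<open>The first slice takes the whole interval. Nonemptiness gives the real infimum its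
  meaning; \<open>N\<close> at least 1 keeps the endpoints 0 and \<open>T\<close> at different
  indices, and the maximum with 1 keeps the bound positive.\<close>

lemma slicing_exists:
  assumes "1 \<le> N"
  shows "\<exists>\<epsilon>. slicing N X \<epsilon>"
proof -
  let ?\<tau> = "\<lambda>k \<omega>. if k = 0 then 0 else T"
  let ?s = "SUP k\<in>{1..N}. bmo_norm M F T (stopped_increment X (?\<tau> (k - 1)) (?\<tau> k))"
  have "slicing N X (max ?s 1)"
    unfolding slicing_def
    using T_pos assms by (intro conjI exI[of _ ?\<tau>]) (auto intro: stopping_const)
  then show ?thesis by blast
qed

end

theorem theorem1p2:
  fixes M :: "'a measure" and F :: "real \<Rightarrow> 'a measure" and T :: real
    and \<Phi> :: "real \<Rightarrow> real" and \<Psi> :: "real \<Rightarrow> real \<Rightarrow> real"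
  assumes basis: "stochastic_basis M F T"
    and \<Phi>_pos: "\<And>\<beta>. 1 < \<beta> \<Longrightarrow> 0 < \<Phi> \<beta>"
    and \<Phi>_antimono: "\<And>\<beta>\<^sub>1 \<beta>\<^sub>2. 1 < \<beta>\<^sub>1 \<Longrightarrow> \<beta>\<^sub>1 \<le> \<beta>\<^sub>2 \<Longrightarrow> \<Phi> \<beta>\<^sub>2 \<le> \<Phi> \<beta>\<^sub>1"
    and \<Psi>_nonneg: "\<And>\<gamma> \<beta>. 1 < \<beta> \<Longrightarrow> 0 \<le> \<gamma> \<Longrightarrow> \<gamma> < \<Phi> \<beta> \<Longrightarrow> 0 \<le> \<Psi> \<gamma> \<beta>"
    and \<Psi>_right_cont: "\<And>\<gamma> \<beta>. 1 < \<beta> \<Longrightarrow> 0 \<le> \<gamma> \<Longrightarrow> \<gamma> < \<Phi> \<beta> \<Longrightarrow>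
          continuous (at_right \<gamma>) (\<lambda>\<gamma>'. \<Psi> \<gamma>' \<beta>)"
    and \<Psi>_mono: "\<And>\<gamma>\<^sub>1 \<gamma>\<^sub>2 \<beta>. 1 < \<beta> \<Longrightarrow> 0 \<le> \<gamma>\<^sub>1 \<Longrightarrow> \<gamma>\<^sub>1 \<le> \<gamma>\<^sub>2 \<Longrightarrow> \<gamma>\<^sub>2 < \<Phi> \<beta> \<Longrightarrow>
          \<Psi> \<gamma>\<^sub>1 \<beta> \<le> \<Psi> \<gamma>\<^sub>2 \<beta>"
    and RH_bound: "\<And>X Q \<beta>. bmo_martingale M F T X \<Longrightarrow> is_bracket M F T X Q \<Longrightarrow> 1 < \<beta> \<Longrightarrow>
          bmo_norm M F T X < \<Phi> \<beta> \<Longrightarrow>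
          reverse_Hoelder M F T \<beta> (stoch_exp X Q) \<le> ennreal (\<Psi> (bmo_norm M F T X) \<beta>)"
  shows "\<forall>X Q \<beta> N. bmo_martingale M F T X \<longrightarrow> is_bracket M F T X Q \<longrightarrow> 1 < \<beta> \<longrightarrow> 1 \<le> N \<longrightarrow>
          sliceable_number M F T N X < \<Phi> \<beta> \<longrightarrow>
          reverse_Hoelder M F T \<beta> (stoch_exp X Q)
            \<le> ennreal (\<Psi> (sliceable_number M F T N X) \<beta> ^ N)"
proof (intro allI impI)
  fix X Q :: "real \<Rightarrow> 'a \<Rightarrow> real" and \<beta> :: real and N :: nat
  assume X: "bmo_martingale M F T X" and Q: "is_bracket M F T X Q" and \<beta>: "1 < \<beta>" and N: "1 \<le> N"
    and small: "sliceable_number M F T N X < \<Phi> \<beta>"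
  interpret stochastic_basis M F T by (rule basis)
  define s where "s = sliceable_number M F T N X"
  have s_Inf: "s = Inf {\<epsilon>. slicing N X \<epsilon>}"
    unfolding s_def sliceable_number_def slicing_def ..
  have ne: "{\<epsilon>. slicing N X \<epsilon>} \<noteq> {}" using slicing_exists[OF N] by blast
  have s0: "0 \<le> s" unfolding s_Inf using ne by (intro cInf_greatest) (auto simp: slicing_def)
  have s\<Phi>: "s < \<Phi> \<beta>" using small by (simp only: s_def)
  have \<beta>0: "0 < \<beta>" using \<beta> by simp
  have regX: "regular X" by (rule bmo_martingaleD(2)[OF X])
  have regQ: "regular Q" using Q by (simp add: is_bracket_def regular_def)
  have RH: "reverse_Hoelder M F T \<beta> (stoch_exp X Q) \<le> ennreal (c ^ N)" if c: "\<Psi> s \<beta> < c" for c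
  proof -
    have c0: "0 < c" using \<Psi>_nonneg[OF \<beta> s0 s\<Phi>] c by simp
    \<comment> \<open>Right-continuity provides a level \<open>e\<close> above \<open>s\<close> at
      which \<Psi> is still below \<open>c\<close> and which is still admissible for \<Phi>; some
      slicing beats \<open>e\<close> by definition of the infimum.\<close>
    have "\<forall>\<^sub>F x in at_right s. \<Psi> x \<beta> < c"
      using \<Psi>_right_cont[OF \<beta> s0 s\<Phi>] c by (intro order_tendstoD(2)) (auto simp: continuous_within)
    moreover have "\<forall>\<^sub>F x in at_right s. s < x \<and> x < \<Phi> \<beta>"
      using s\<Phi> by (auto simp: eventually_at_right_field)
    ultimately have "\<forall>\<^sub>F x in at_right s. \<Psi> x \<beta> < c \<and> s < x \<and> x < \<Phi> \<beta>"
      by eventually_elim blast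
    then obtain e where e: "\<Psi> e \<beta> < c" "s < e" "e < \<Phi> \<beta>"
      using eventually_happens[of _ "at_right s"] by (auto simp: trivial_limit_at_right_real)
    obtain \<epsilon> where "slicing N X \<epsilon>" "\<epsilon> < e"
      using cInf_lessD[OF ne, of e] e(2) unfolding s_Inf by blast
    then obtain \<tau> where \<tau>: "\<And>k. k \<le> N \<Longrightarrow> stopping (\<tau> k)"
      and ends: "\<And>\<omega>. \<omega> \<in> space M \<Longrightarrow> \<tau> 0 \<omega> = 0" "\<And>\<omega>. \<omega> \<in> space M \<Longrightarrow> \<tau> N \<omega> = T"
      and le: "\<And>k \<omega>. k < N \<Longrightarrow> \<omega> \<in> space M \<Longrightarrow> \<tau> k \<omega> \<le> \<tau> (Suc k) \<omega>"
      and sup: "(SUP k\<in>{1..N}. bmo_norm M F T (stopped_increment X (\<tau> (k - 1)) (\<tau> k))) \<le> \<epsilon>"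
      unfolding slicing_def by blast
    have "reverse_Hoelder_bound \<beta> (stoch_exp X Q) (c ^ N)"
    proof (rule reverse_Hoelder_bound_product[OF regX regQ \<beta>0 less_imp_le[OF c0] \<tau> ends le])
      fix k assume k: "k < N"
      let ?Y = "stopped_increment X (\<tau> k) (\<tau> (Suc k))" and ?R = "stopped_increment Q (\<tau> k) (\<tau> (Suc k))"
      have kN: "k \<le> N" "Suc k \<le> N" using k by auto
      have Y: "bmo_martingale M F T ?Y"
        by (rule bmo_martingale_stopped_increment[OF X \<tau>[OF kN(1)] \<tau>[OF kN(2)] le[OF k]])
      have R: "is_bracket M F T ?Y ?R"
        by (rule is_bracket_stopped_increment[OF X Q \<tau>[OF kN(1)] \<tau>[OF kN(2)] le[OF k]])
      \<comment> \<open>The index set is finite, so the supremum dominates each member; the slice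
        from \<open>\<tau> k\<close> has index \<open>Suc k\<close> there.\<close>
      have "bmo_norm M F T ?Y \<le> (SUP k\<in>{1..N}. bmo_norm M F T (stopped_increment X (\<tau> (k - 1)) (\<tau> k)))"
        by (rule cSUP_upper2[of _ _ "Suc k"]) (use k in auto)
      then have n: "bmo_norm M F T ?Y \<le> e" using sup \<open>\<epsilon> < e\<close> by linarith
      have "reverse_Hoelder M F T \<beta> (stoch_exp ?Y ?R) \<le> ennreal (\<Psi> (bmo_norm M F T ?Y) \<beta>)"
        by (rule RH_bound[OF Y R \<beta> le_less_trans[OF n e(3)]])
      also have "\<dots> < ennreal c"
        using le_less_trans[OF \<Psi>_mono[OF \<beta> bmo_norm_nonneg[OF Y] n e(3)] e(1)] c0 by (simp add: ennreal_lessI)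
      finally show "reverse_Hoelder_bound \<beta> (stoch_exp ?Y ?R) c"
        by (rule reverse_Hoelder_lessD[OF \<beta>0 stoch_exp_nonneg less_imp_le[OF c0]])
    qed
    then show ?thesis
      by (rule reverse_Hoelder_leI[OF \<beta>0 stoch_exp_nonneg zero_le_power[OF less_imp_le[OF c0]]])
  qed
  \<comment> \<open>The bound holds for every \<open>c\<close> strictly above the target value;
    continuity of the power lets \<open>c\<close> decrease to it.\<close>
  have "((\<lambda>c. ennreal (c ^ N)) \<longlongrightarrow> ennreal (\<Psi> s \<beta> ^ N)) (at_right (\<Psi> s \<beta>))"
    by (intro tendsto_ennrealI tendsto_power tendsto_ident_at)
  then have "reverse_Hoelder M F T \<beta> (stoch_exp X Q) \<le> ennreal (\<Psi> s \<beta> ^ N)"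
    by (rule tendsto_lowerbound)
      (auto simp: eventually_at_filter RH trivial_limit_at_right_real)
  then show "reverse_Hoelder M F T \<beta> (stoch_exp X Q) \<le> ennreal (\<Psi> (sliceable_number M F T N X) \<beta> ^ N)"
    unfolding s_def .
qed

end
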